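(* Let $H:T^*M\times\mathbb S^1\to\mathbb R$ be a convex superlinear Hamiltonian. For every cohomology class $[\omega]\in H^1(M,\mathbb R)$, $$\alpha([\omega])\le c(H,[\omega]).$$
   Context: Let $(M,\langle\cdot,\cdot\rangle)$ be a compact connected orientable Riemannian manifold having no nontrivial contractible closed geodesics, and $\mathbb S^1=\mathbb R/\mathbb Z$. $H:T^*M\times\mathbb S^1\to\mathbb R$ is smooth, convex (positive definite fibrewise Hessian) and fibrewise superlinear, with Legendre transform $L:TM\times\mathbb S^1\to\mathbb R$, $L(q,v,t)=\max_{p\in T_q^*M}\{p(v)-H(q,p,t)\}$, whose Euler–Lagrange flow is complete. Mather's functions: $\mathcal M(L)$ is the set of compactly supported Borel probability measures on $TM\times\mathbb S^1$ invariant under the Euler–Lagrange flow. The rotation vector of $\mu\in\mathcal M(L)$ is the unique $\rho(\mu)\in H_1(M,\mathbb R)$ with $\langle\omega,\rho(\mu)\rangle=\int\omega\,d\mu$ for all closed 1-forms $\omega$ on $M$ (viewed as functions on $TM$). $\beta:H_1(M,\mathbb R)\to\mathbb R$ is $\beta(\gamma)=\inf\{\int L\,d\mu:\mu\in\mathcal M(L),\rho(\mu)=\gamma\}$, and $\alpha:H^1(M,\mathbb R)\to\mathbb R$ is the convex dual of $\beta$, $\alpha(c)=\sup_{\gamma\in H_1(M,\mathbb R)}\{\langle c,\gamma\rangle-\beta(\gamma)\}$. For $[\omega]\in H^1(M,\mathbb R)$, $$c(H,[\omega])=\inf\left\{\int_0^1\max_{q\in M}H(q,\theta(q),t)\,dt:\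 \theta\text{ a closed 1-form with }\theta\in[\omega]\right\}.$$ *)

theory Defs
  imports "HOL-Analysis.Analysis" "HOL-Probability.Probability"
begin

section \<open>Smooth maps between normed spaces\<close>

text \<open>Only used for open \<open>S\<close>; the derivative is the unrestricted one.\<close>

primrec times_differentiable_on ::
    "nat \<Rightarrow> 'a::real_normed_vector set \<Rightarrow> ('a \<Rightarrow> 'b::real_normed_vector) \<Rightarrow> bool" where
  "times_differentiable_on 0 S f \<longleftrightarrow> continuous_on S f"
| "times_differentiable_on (Suc k) S f \<longleftrightarrow>
     (\<forall>x\<in>S. f differentiable at x) \<and>
     (\<forall>v. times_differentiable_on k S (\<lambda>x. frechet_derivative f (at x) v))"

definition smooth_on :: "'a::real_normed_vector set \<Rightarrow> ('a \<Rightarrow> 'b::real_normed_vector) \<Rightarrow> bool" where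
  "smooth_on S f \<longleftrightarrow> (\<forall>k. times_differentiable_on k S f)"


section \<open>Smooth manifolds\<close>

text \<open>The manifold is the whole type \<open>'m\<close>; its dimension is \<open>CARD('n)\<close>. A chart is a pair of a
  domain and a coordinate map, whose values outside the domain are irrelevant.\<close>

type_synonym ('m, 'n) chart = "'m set \<times> ('m \<Rightarrow> real ^ 'n)"

abbreviation dom_of :: "('m, 'n) chart \<Rightarrow> 'm set" where
  "dom_of c \<equiv> fst c"

abbreviation coord :: "('m, 'n) chart \<Rightarrow> 'm \<Rightarrow> real ^ 'n" where
  "coord c \<equiv> snd c"

definition img_of :: "('m, 'n) chart \<Rightarrow> (real ^ 'n) set" where
  "img_of c = coord c ` dom_of c"

definition point :: "('m, 'n) chart \<Rightarrow> real ^ 'n \<Rightarrow> 'm" where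
  "point c = inv_into (dom_of c) (coord c)"

definition is_chart :: "('m::topological_space, 'n::finite) chart \<Rightarrow> bool" where
  "is_chart c \<longleftrightarrow> open (dom_of c) \<and> open (img_of c) \<and>
     homeomorphism (dom_of c) (img_of c) (coord c) (point c)"

definition transition :: "('m, 'n) chart \<Rightarrow> ('m, 'n) chart \<Rightarrow> real ^ 'n \<Rightarrow> real ^ 'n" where
  "transition c d = coord d \<circ> point c"

definition smooth_atlas :: "('m::topological_space, 'n::finite) chart set \<Rightarrow> bool" where
  "smooth_atlas A \<longleftrightarrow> (\<forall>c\<in>A. is_chart c) \<and> (\<Union>c\<in>A. dom_of c) = UNIV \<and>
     (\<forall>c\<in>A. \<forall>d\<in>A. smooth_on (coord c ` (dom_of c \<inter> dom_of d)) (transition c d))"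

definition orientable :: "('m::topological_space, 'n::finite) chart set \<Rightarrow> bool" where
  "orientable A \<longleftrightarrow> (\<exists>B. smooth_atlas B \<and> smooth_atlas (A \<union> B) \<and>
     (\<forall>c\<in>B. \<forall>d\<in>B. \<forall>q\<in>dom_of c \<inter> dom_of d.
        det (matrix (frechet_derivative (transition c d) (at (coord c q)))) > 0))"

definition smooth_map ::
    "('m::topological_space, 'n::finite) chart set \<Rightarrow> 'e::real_normed_vector set \<Rightarrow> ('e \<Rightarrow> 'm) \<Rightarrow> bool" where
  "smooth_map A W f \<longleftrightarrow> open W \<and> continuous_on W f \<and>
     (\<forall>c\<in>A. smooth_on (W \<inter> f -` dom_of c) (coord c \<circ> f))"

definition smooth_function :: "('m::topological_space, 'n::finite) chart set \<Rightarrow> ('m \<Rightarrow> real) \<Rightarrow> bool" where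
  "smooth_function A f \<longleftrightarrow> (\<forall>c\<in>A. smooth_on (img_of c) (f \<circ> point c))"


section \<open>Tangent and cotangent spaces\<close>

text \<open>A tangent vector at \<open>q\<close> is the family of its coordinate vectors in all charts around \<open>q\<close>,
  which transforms by the Jacobians of the transition maps; its value at other charts is set to
  \<open>0\<close>. Covectors are extended by \<open>0\<close> outside the tangent space, so that equal covectors are equal
  as functions.\<close>

type_synonym ('m, 'n) tvec = "('m, 'n) chart \<Rightarrow> real ^ 'n"
type_synonym ('m, 'n) covec = "('m, 'n) tvec \<Rightarrow> real"

definition tangent_space :: "('m, 'n::finite) chart set \<Rightarrow> 'm \<Rightarrow> ('m, 'n) tvec set" where
  "tangent_space A q = {X.
     (\<forall>c\<in>A. \<forall>d\<in>A. q \<in> dom_of c \<and> q \<in> dom_of d \<longrightarrow>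
        X d = frechet_derivative (transition c d) (at (coord c q)) (X c)) \<and>
     (\<forall>c. \<not> (c \<in> A \<and> q \<in> dom_of c) \<longrightarrow> X c = 0)}"

definition linear_on_tangent ::
    "('m, 'n::finite) chart set \<Rightarrow> 'm \<Rightarrow> ('m, 'n) covec \<Rightarrow> bool" where
  "linear_on_tangent A q p \<longleftrightarrow> (\<forall>X\<in>tangent_space A q. \<forall>Y\<in>tangent_space A q. \<forall>a b.
     p (\<lambda>c. a *\<^sub>R X c + b *\<^sub>R Y c) = a * p X + b * p Y)"

definition cotangent_space :: "('m, 'n::finite) chart set \<Rightarrow> 'm \<Rightarrow> ('m, 'n) covec set" where
  "cotangent_space A q = {p. linear_on_tangent A q p \<and> (\<forall>X. X \<notin> tangent_space A q \<longrightarrow> p X = 0)}"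

text \<open>The vector, respectively covector, at \<open>q\<close> with coordinates \<open>y\<close> in the chart \<open>c\<close>.\<close>

definition tangent_vector ::
    "('m, 'n::finite) chart set \<Rightarrow> ('m, 'n) chart \<Rightarrow> 'm \<Rightarrow> real ^ 'n \<Rightarrow> ('m, 'n) tvec" where
  "tangent_vector A c q y = (\<lambda>d. if d \<in> A \<and> q \<in> dom_of d
     then frechet_derivative (transition c d) (at (coord c q)) y else 0)"

definition cotangent_vector ::
    "('m, 'n::finite) chart set \<Rightarrow> ('m, 'n) chart \<Rightarrow> 'm \<Rightarrow> real ^ 'n \<Rightarrow> ('m, 'n) covec" where
  "cotangent_vector A c q y = (\<lambda>X. if X \<in> tangent_space A q then y \<bullet> X c else 0)"

definition velocity :: "('m, 'n::finite) chart set \<Rightarrow> (real \<Rightarrow> 'm) \<Rightarrow> real \<Rightarrow> ('m, 'n) tvec" where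
  "velocity A \<gamma> t = (\<lambda>c. if c \<in> A \<and> \<gamma> t \<in> dom_of c
     then vector_derivative (coord c \<circ> \<gamma>) (at t) else 0)"

definition tangent_bundle :: "('m, 'n::finite) chart set \<Rightarrow> ('m \<times> ('m, 'n) tvec) set" where
  "tangent_bundle A = {(q, X). X \<in> tangent_space A q}"

definition tangent_open ::
    "('m, 'n::finite) chart set \<Rightarrow> ('m \<times> ('m, 'n) tvec) set \<Rightarrow> bool" where
  "tangent_open A W \<longleftrightarrow> W \<subseteq> tangent_bundle A \<and>
     (\<forall>c\<in>A. open {(x, y). x \<in> img_of c \<and> (point c x, tangent_vector A c (point c x) y) \<in> W})"

definition tangent_topology ::
    "('m, 'n::finite) chart set \<Rightarrow> ('m \<times> ('m, 'n) tvec) topology" where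
  "tangent_topology A = topology (tangent_open A)"

lemma openin_tangent_topology:
  assumes "smooth_atlas A"
  shows "openin (tangent_topology A) = tangent_open A"
proof -
  have "tangent_open A (S \<inter> T)" if "tangent_open A S" "tangent_open A T" for S T
  proof -
    let ?P = "\<lambda>c W. {(x, y). x \<in> img_of c \<and> (point c x, tangent_vector A c (point c x) y) \<in> W}"
    have "?P c (S \<inter> T) = ?P c S \<inter> ?P c T" for c
      by auto
    then show ?thesis
      using that unfolding tangent_open_def by (auto intro: open_Int)
  qed
  moreover have "tangent_open A (\<Union>K)" if "\<forall>S\<in>K. tangent_open A S" for K
  proof -
    let ?P = "\<lambda>c W. {(x, y). x \<in> img_of c \<and> (point c x, tangent_vector A c (point c x) y) \<in> W}"
    have "?P c (\<Union>K) = (\<Union>S\<in>K. ?P c S)" for c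
      by auto
    then show ?thesis
      using that unfolding tangent_open_def by (auto intro!: open_UN)
  qed
  ultimately have "istopology (tangent_open A)"
    unfolding istopology_def by blast
  then show ?thesis
    unfolding tangent_topology_def by (simp add: topology_inverse')
qed


section \<open>Riemannian metrics and geodesics\<close>

definition metric_coords ::
    "('m, 'n::finite) chart set \<Rightarrow> ('m \<Rightarrow> ('m, 'n) tvec \<Rightarrow> ('m, 'n) tvec \<Rightarrow> real) \<Rightarrow>
     ('m, 'n) chart \<Rightarrow> real ^ 'n \<Rightarrow> real ^ 'n ^ 'n" where
  "metric_coords A g c x = (\<chi> i j. g (point c x)
     (tangent_vector A c (point c x) (axis i 1)) (tangent_vector A c (point c x) (axis j 1)))"

definition riemannian_metric ::
    "('m, 'n::finite) chart set \<Rightarrow> ('m \<Rightarrow> ('m, 'n) tvec \<Rightarrow> ('m, 'n) tvec \<Rightarrow> real) \<Rightarrow> bool" where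
  "riemannian_metric A g \<longleftrightarrow>
     (\<forall>q. \<forall>X\<in>tangent_space A q. linear_on_tangent A q (g q X) \<and>
        (\<forall>Y\<in>tangent_space A q. g q X Y = g q Y X) \<and> (X \<noteq> (\<lambda>_. 0) \<longrightarrow> g q X X > 0)) \<and>
     (\<forall>c\<in>A. smooth_on (img_of c) (metric_coords A g c))"

definition covector_norm ::
    "('m, 'n::finite) chart set \<Rightarrow> ('m \<Rightarrow> ('m, 'n) tvec \<Rightarrow> ('m, 'n) tvec \<Rightarrow> real) \<Rightarrow>
     'm \<Rightarrow> ('m, 'n) covec \<Rightarrow> real" where
  "covector_norm A g q p = (SUP X \<in> {X \<in> tangent_space A q. g q X X \<le> 1}. p X)"

definition partial_deriv :: "'n::finite \<Rightarrow> (real ^ 'n \<Rightarrow> real) \<Rightarrow> real ^ 'n \<Rightarrow> real" where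
  "partial_deriv i f x = frechet_derivative f (at x) (axis i 1)"

text \<open>Christoffel symbols \<open>\<Gamma>\<^sup>k\<^sub>i\<^sub>j\<close> of the Levi-Civita connection in the chart \<open>c\<close>.\<close>

definition christoffel ::
    "('m, 'n::finite) chart set \<Rightarrow> ('m \<Rightarrow> ('m, 'n) tvec \<Rightarrow> ('m, 'n) tvec \<Rightarrow> real) \<Rightarrow>
     ('m, 'n) chart \<Rightarrow> real ^ 'n \<Rightarrow> 'n \<Rightarrow> 'n \<Rightarrow> 'n \<Rightarrow> real" where
  "christoffel A g c x k i j = (let G = metric_coords A g c in
     (1/2) * (\<Sum>l\<in>UNIV. matrix_inv (G x) $ k $ l *
       (partial_deriv i (\<lambda>z. G z $ j $ l) x + partial_deriv j (\<lambda>z. G z $ i $ l) x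
        - partial_deriv l (\<lambda>z. G z $ i $ j) x)))"

definition geodesic ::
    "('m::topological_space, 'n::finite) chart set \<Rightarrow>
     ('m \<Rightarrow> ('m, 'n) tvec \<Rightarrow> ('m, 'n) tvec \<Rightarrow> real) \<Rightarrow> (real \<Rightarrow> 'm) \<Rightarrow> bool" where
  "geodesic A g \<gamma> \<longleftrightarrow> smooth_map A UNIV \<gamma> \<and>
     (\<forall>c\<in>A. \<forall>t. \<gamma> t \<in> dom_of c \<longrightarrow>
       (let x = coord c \<circ> \<gamma>;
            x' = (\<lambda>s. vector_derivative x (at s));
            x'' = vector_derivative x' (at t)
        in \<forall>k. x'' $ k +
             (\<Sum>i\<in>UNIV. \<Sum>j\<in>UNIV. christoffel A g c (x t) k i j * x' t $ i * x' t $ j) = 0))"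

definition closed_geodesic ::
    "('m::topological_space, 'n::finite) chart set \<Rightarrow>
     ('m \<Rightarrow> ('m, 'n) tvec \<Rightarrow> ('m, 'n) tvec \<Rightarrow> real) \<Rightarrow> real \<Rightarrow> (real \<Rightarrow> 'm) \<Rightarrow> bool" where
  "closed_geodesic A g T \<gamma> \<longleftrightarrow> geodesic A g \<gamma> \<and> T > 0 \<and> (\<forall>s. \<gamma> (s + T) = \<gamma> s)"

definition no_contractible_closed_geodesics ::
    "('m::topological_space, 'n::finite) chart set \<Rightarrow>
     ('m \<Rightarrow> ('m, 'n) tvec \<Rightarrow> ('m, 'n) tvec \<Rightarrow> real) \<Rightarrow> bool" where
  "no_contractible_closed_geodesics A g \<longleftrightarrow>
     (\<forall>T \<gamma>. closed_geodesic A g T \<gamma> \<and> (\<exists>a. homotopic_loops UNIV (\<lambda>s. \<gamma> (T * s)) (\<lambda>_. a))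
        \<longrightarrow> (\<forall>s. \<gamma> s = \<gamma> 0))"


section \<open>Differential 1-forms and first de Rham cohomology\<close>

type_synonym ('m, 'n) one_form = "'m \<Rightarrow> ('m, 'n) covec"

definition form_coords ::
    "('m, 'n::finite) chart set \<Rightarrow> ('m, 'n) one_form \<Rightarrow> ('m, 'n) chart \<Rightarrow> real ^ 'n \<Rightarrow> real ^ 'n" where
  "form_coords A \<theta> c x = (\<chi> i. \<theta> (point c x) (tangent_vector A c (point c x) (axis i 1)))"

definition closed_forms :: "('m::topological_space, 'n::finite) chart set \<Rightarrow> ('m, 'n) one_form set" where
  "closed_forms A = {\<theta>. (\<forall>q. \<theta> q \<in> cotangent_space A q) \<and>
     (\<forall>c\<in>A. smooth_on (img_of c) (form_coords A \<theta> c) \<and>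
        (\<forall>x\<in>img_of c. \<forall>i j. partial_deriv i (\<lambda>z. form_coords A \<theta> c z $ j) x
                              = partial_deriv j (\<lambda>z. form_coords A \<theta> c z $ i) x))}"

definition is_differential ::
    "('m, 'n::finite) chart set \<Rightarrow> ('m \<Rightarrow> real) \<Rightarrow> ('m, 'n) one_form \<Rightarrow> bool" where
  "is_differential A f \<theta> \<longleftrightarrow> (\<forall>c\<in>A. \<forall>q\<in>dom_of c. \<forall>X\<in>tangent_space A q.
     \<theta> q X = frechet_derivative (f \<circ> point c) (at (coord c q)) (X c))"

definition cohomologous ::
    "('m::topological_space, 'n::finite) chart set \<Rightarrow> (('m, 'n) one_form \<times> ('m, 'n) one_form) set" where
  "cohomologous A = {(\<omega>, \<theta>). \<omega> \<in> closed_forms A \<and> \<theta> \<in> closed_forms A \<and>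
     (\<exists>f. smooth_function A f \<and> is_differential A f (\<lambda>q X. \<theta> q X - \<omega> q X))}"

definition de_rham_H1 :: "('m::topological_space, 'n::finite) chart set \<Rightarrow> ('m, 'n) one_form set set" where
  "de_rham_H1 A = closed_forms A // cohomologous A"


section \<open>First real homology\<close>

text \<open>Smooth singular homology with real coefficients. Simplices are restricted to their parameter
  domain and chains are finitely supported real-valued functions on simplices.\<close>

definition smooth_simplex ::
    "('m::topological_space, 'n::finite) chart set \<Rightarrow> 'e::real_normed_vector set \<Rightarrow> ('e \<Rightarrow> 'm) \<Rightarrow> bool" where
  "smooth_simplex A S \<sigma> \<longleftrightarrow> \<sigma> \<in> extensional S \<and>
     (\<exists>W f. S \<subseteq> W \<and> smooth_map A W f \<and> (\<forall>t\<in>S. \<sigma> t = f t))"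

definition unit_triangle :: "(real \<times> real) set" where
  "unit_triangle = {(s, t). 0 \<le> s \<and> 0 \<le> t \<and> s + t \<le> 1}"

definition smooth_chains ::
    "('m::topological_space, 'n::finite) chart set \<Rightarrow> 'e::real_normed_vector set \<Rightarrow>
     (('e \<Rightarrow> 'm) \<Rightarrow> real) set" where
  "smooth_chains A S = {z. finite {\<sigma>. z \<sigma> \<noteq> 0} \<and> (\<forall>\<sigma>. z \<sigma> \<noteq> 0 \<longrightarrow> smooth_simplex A S \<sigma>)}"

definition boundary1 :: "((real \<Rightarrow> 'm) \<Rightarrow> real) \<Rightarrow> 'm \<Rightarrow> real" where
  "boundary1 z x = (\<Sum>\<sigma> | z \<sigma> \<noteq> 0. z \<sigma> * (of_bool (\<sigma> 1 = x) - of_bool (\<sigma> 0 = x)))"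

text \<open>The faces of a triangle with vertices \<open>v\<^sub>0 = (0,0)\<close>, \<open>v\<^sub>1 = (1,0)\<close>, \<open>v\<^sub>2 = (0,1)\<close>, the
  \<open>i\<close>-th one omitting \<open>v\<^sub>i\<close>.\<close>

definition face0 :: "(real \<times> real \<Rightarrow> 'm) \<Rightarrow> real \<Rightarrow> 'm" where
  "face0 \<tau> = restrict (\<lambda>u. \<tau> (1 - u, u)) {0..1}"

definition face1 :: "(real \<times> real \<Rightarrow> 'm) \<Rightarrow> real \<Rightarrow> 'm" where
  "face1 \<tau> = restrict (\<lambda>u. \<tau> (0, u)) {0..1}"

definition face2 :: "(real \<times> real \<Rightarrow> 'm) \<Rightarrow> real \<Rightarrow> 'm" where
  "face2 \<tau> = restrict (\<lambda>u. \<tau> (u, 0)) {0..1}"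

definition boundary2 :: "((real \<times> real \<Rightarrow> 'm) \<Rightarrow> real) \<Rightarrow> (real \<Rightarrow> 'm) \<Rightarrow> real" where
  "boundary2 b \<sigma> = (\<Sum>\<tau> | b \<tau> \<noteq> 0. b \<tau> *
     (of_bool (\<sigma> = face0 \<tau>) - of_bool (\<sigma> = face1 \<tau>) + of_bool (\<sigma> = face2 \<tau>)))"

definition cycles1 :: "('m::topological_space, 'n::finite) chart set \<Rightarrow> ((real \<Rightarrow> 'm) \<Rightarrow> real) set" where
  "cycles1 A = {z \<in> smooth_chains A {0..1}. \<forall>x. boundary1 z x = 0}"

definition homologous ::
    "('m::topological_space, 'n::finite) chart set \<Rightarrow>
     (((real \<Rightarrow> 'm) \<Rightarrow> real) \<times> ((real \<Rightarrow> 'm) \<Rightarrow> real)) set" where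
  "homologous A = {(y, z). y \<in> cycles1 A \<and> z \<in> cycles1 A \<and>
     (\<exists>b\<in>smooth_chains A unit_triangle. \<forall>\<sigma>. z \<sigma> - y \<sigma> = boundary2 b \<sigma>)}"

definition real_H1 ::
    "('m::topological_space, 'n::finite) chart set \<Rightarrow> ((real \<Rightarrow> 'm) \<Rightarrow> real) set set" where
  "real_H1 A = cycles1 A // homologous A"

definition chain_integral ::
    "('m, 'n::finite) chart set \<Rightarrow> ('m, 'n) one_form \<Rightarrow> ((real \<Rightarrow> 'm) \<Rightarrow> real) \<Rightarrow> real" where
  "chain_integral A \<omega> z =
     (\<Sum>\<sigma> | z \<sigma> \<noteq> 0. z \<sigma> * integral {0..1} (\<lambda>t. \<omega> (\<sigma> t) (velocity A \<sigma> t)))"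

text \<open>By Stokes' theorem the pairing does not depend on the representatives.\<close>

definition pairing ::
    "('m, 'n::finite) chart set \<Rightarrow> ('m, 'n) one_form set \<Rightarrow> ((real \<Rightarrow> 'm) \<Rightarrow> real) set \<Rightarrow> real" where
  "pairing A C h = chain_integral A (SOME \<omega>. \<omega> \<in> C) (SOME z. z \<in> h)"


section \<open>The circle \<open>\<real>/\<int>\<close>\<close>

quotient_type circle = real / "\<lambda>s t::real. s - t \<in> \<int>"
proof (rule equivpI)
  show "reflp (\<lambda>s t::real. s - t \<in> \<int>)"
    by (simp add: reflp_def)
  show "symp (\<lambda>s t::real. s - t \<in> \<int>)"
    by (metis Ints_minus minus_diff_eq sympI)
  show "transp (\<lambda>s t::real. s - t \<in> \<int>)"
  proof (rule transpI)
    fix x y z :: real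
    assume "x - y \<in> \<int>" "y - z \<in> \<int>"
    then have "(x - y) + (y - z) \<in> \<int>"
      by (rule Ints_add)
    then show "x - z \<in> \<int>"
      by simp
  qed
qed

instantiation circle :: topological_space
begin

definition open_circle :: "circle set \<Rightarrow> bool" where
  "open_circle U \<longleftrightarrow> open (abs_circle -` U)"

instance
  by standard (auto simp: open_circle_def vimage_Int vimage_Union intro!: open_Int open_UN)

end


section \<open>Hamiltonians and Lagrangians\<close>

text \<open>Functions on \<open>T\<^sup>*M \<times> S\<^sup>1\<close> and \<open>TM \<times> S\<^sup>1\<close>; only their values at covectors and vectors based at
  the given point matter.\<close>

type_synonym ('m, 'n) hamiltonian = "'m \<Rightarrow> ('m, 'n) covec \<Rightarrow> circle \<Rightarrow> real"
type_synonym ('m, 'n) lagrangian = "'m \<Rightarrow> ('m, 'n) tvec \<Rightarrow> circle \<Rightarrow> real"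

definition smooth_hamiltonian ::
    "('m::topological_space, 'n::finite) chart set \<Rightarrow> ('m, 'n) hamiltonian \<Rightarrow> bool" where
  "smooth_hamiltonian A H \<longleftrightarrow> (\<forall>c\<in>A. smooth_on (img_of c \<times> UNIV \<times> UNIV)
     (\<lambda>(x, y, t). H (point c x) (cotangent_vector A c (point c x) y) (abs_circle t)))"

definition positive_fibre_hessian ::
    "('m, 'n::finite) chart set \<Rightarrow> ('m, 'n) hamiltonian \<Rightarrow> bool" where
  "positive_fibre_hessian A H \<longleftrightarrow>
     (\<forall>q \<tau>. \<forall>p\<in>cotangent_space A q. \<forall>w\<in>cotangent_space A q. w \<noteq> (\<lambda>_. 0) \<longrightarrow>
        (deriv ^^ 2) (\<lambda>s. H q (\<lambda>X. p X + s * w X) \<tau>) 0 > 0)"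

definition superlinear ::
    "('m, 'n::finite) chart set \<Rightarrow> ('m \<Rightarrow> ('m, 'n) tvec \<Rightarrow> ('m, 'n) tvec \<Rightarrow> real) \<Rightarrow>
     ('m, 'n) hamiltonian \<Rightarrow> bool" where
  "superlinear A g H \<longleftrightarrow> (\<forall>q \<tau> K. \<exists>R. \<forall>p\<in>cotangent_space A q.
     covector_norm A g q p \<ge> R \<longrightarrow> H q p \<tau> \<ge> K * covector_norm A g q p)"

definition legendre :: "('m, 'n::finite) chart set \<Rightarrow> ('m, 'n) hamiltonian \<Rightarrow> ('m, 'n) lagrangian" where
  "legendre A H q v \<tau> = (SUP p\<in>cotangent_space A q. p v - H q p \<tau>)"

definition lagrangian_coords ::
    "('m, 'n::finite) chart set \<Rightarrow> ('m, 'n) lagrangian \<Rightarrow> ('m, 'n) chart \<Rightarrow>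
     real ^ 'n \<Rightarrow> real ^ 'n \<Rightarrow> real \<Rightarrow> real" where
  "lagrangian_coords A L c x y t = L (point c x) (tangent_vector A c (point c x) y) (abs_circle t)"

text \<open>The Euler-Lagrange equation \<open>d/dt (\<partial>L/\<partial>v) = \<partial>L/\<partial>q\<close> in every chart; the time variable of the
  curve is the lift to \<open>\<real>\<close> of the circle variable of \<open>L\<close>.\<close>

definition euler_lagrange ::
    "('m::topological_space, 'n::finite) chart set \<Rightarrow> ('m, 'n) lagrangian \<Rightarrow> (real \<Rightarrow> 'm) \<Rightarrow> bool" where
  "euler_lagrange A L \<gamma> \<longleftrightarrow> smooth_map A UNIV \<gamma> \<and>
     (\<forall>c\<in>A. \<forall>t. \<gamma> t \<in> dom_of c \<longrightarrow>
       (let x = coord c \<circ> \<gamma>;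
            x' = (\<lambda>s. vector_derivative x (at s));
            l = lagrangian_coords A L c
        in \<forall>i. ((\<lambda>s. partial_deriv i (\<lambda>y. l (x s) y s) (x' s))
              has_real_derivative partial_deriv i (\<lambda>z. l z (x' t) t) (x t)) (at t)))"

definition complete_flow ::
    "('m::topological_space, 'n::finite) chart set \<Rightarrow> ('m, 'n) lagrangian \<Rightarrow> bool" where
  "complete_flow A L \<longleftrightarrow> (\<forall>q t. \<forall>v\<in>tangent_space A q.
     \<exists>\<gamma>. euler_lagrange A L \<gamma> \<and> \<gamma> t = q \<and> velocity A \<gamma> t = v)"

definition flow ::
    "('m::topological_space, 'n::finite) chart set \<Rightarrow> ('m, 'n) lagrangian \<Rightarrow> real \<Rightarrow>
     ('m \<times> ('m, 'n) tvec) \<times> circle \<Rightarrow> ('m \<times> ('m, 'n) tvec) \<times> circle" where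
  "flow A L s = (\<lambda>((q, v), \<tau>). let t = rep_circle \<tau>;
       \<gamma> = (THE \<gamma>. euler_lagrange A L \<gamma> \<and> \<gamma> t = q \<and> velocity A \<gamma> t = v)
     in ((\<gamma> (t + s), velocity A \<gamma> (t + s)), abs_circle (t + s)))"


section \<open>Mather's functions and the critical value\<close>

definition phase_space ::
    "('m, 'n::finite) chart set \<Rightarrow> (('m \<times> ('m, 'n) tvec) \<times> circle) topology" where
  "phase_space A = prod_topology (tangent_topology A) euclidean"

definition invariant_measures ::
    "('m::topological_space, 'n::finite) chart set \<Rightarrow> ('m, 'n) lagrangian \<Rightarrow>
     (('m \<times> ('m, 'n) tvec) \<times> circle) measure set" where
  "invariant_measures A L = {\<mu>. prob_space \<mu> \<and>
     sets \<mu> = sets (sigma (topspace (phase_space A)) {U. openin (phase_space A) U}) \<and>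
     (\<exists>K. compactin (phase_space A) K \<and> (AE z in \<mu>. z \<in> K)) \<and>
     (\<forall>s. flow A L s \<in> \<mu> \<rightarrow>\<^sub>M \<mu> \<and> distr \<mu> \<mu> (flow A L s) = \<mu>)}"

text \<open>\<open>\<rho>(\<mu>) = h\<close>\<close>

definition has_rotation_vector ::
    "('m::topological_space, 'n::finite) chart set \<Rightarrow>
     (('m \<times> ('m, 'n) tvec) \<times> circle) measure \<Rightarrow> ((real \<Rightarrow> 'm) \<Rightarrow> real) set \<Rightarrow> bool" where
  "has_rotation_vector A \<mu> h \<longleftrightarrow> h \<in> real_H1 A \<and>
     (\<forall>\<omega>\<in>closed_forms A. pairing A (cohomologous A `` {\<omega>}) h = (\<integral>((q, v), \<tau>). \<omega> q v \<partial>\<mu>))"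

text \<open>Infima and suprema are taken in the extended reals, so that no finiteness of
  \<open>\<alpha>\<close> and \<open>\<beta>\<close> has to be presupposed.\<close>

definition mather_beta ::
    "('m::topological_space, 'n::finite) chart set \<Rightarrow> ('m, 'n) lagrangian \<Rightarrow>
     ((real \<Rightarrow> 'm) \<Rightarrow> real) set \<Rightarrow> ereal" where
  "mather_beta A L h = (INF \<mu>\<in>{\<mu> \<in> invariant_measures A L. has_rotation_vector A \<mu> h}.
     ereal (\<integral>((q, v), \<tau>). L q v \<tau> \<partial>\<mu>))"

definition mather_alpha ::
    "('m::topological_space, 'n::finite) chart set \<Rightarrow> ('m, 'n) lagrangian \<Rightarrow>
     ('m, 'n) one_form set \<Rightarrow> ereal" where
  "mather_alpha A L C = (SUP h\<in>real_H1 A. ereal (pairing A C h) - mather_beta A L h)"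

definition critical_value ::
    "('m::topological_space, 'n::finite) chart set \<Rightarrow> ('m, 'n) hamiltonian \<Rightarrow>
     ('m, 'n) one_form set \<Rightarrow> ereal" where
  "critical_value A H C =
     (INF \<theta>\<in>C. ereal (integral {0..1} (\<lambda>t. SUP q. H q (\<theta> q) (abs_circle t))))"

end

theory Submission
  imports Defs
begin

text \<open>For a closed form \<open>\<theta>\<close> in the class, Fenchel's inequality gives
  \<open>\<theta>(v) - L(q,v,t) \<le> H(q,\<theta>(q),t) \<le> max\<^sub>q H(q,\<theta>(q),t)\<close>. Integrate this against an invariant
  measure with rotation vector \<open>h\<close>: the left-hand side becomes \<open>\<langle>[\<theta>],h\<rangle> - \<integral>L\<close>, and the right-hand
  side, a function of time only, becomes its average over the circle, because the flow rotates the
  time circle and the only rotation invariant probability measure there is Lebesgue measure.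
  The integral of a non-integrable function is \<open>0\<close> by convention, so \<open>L\<close> has to be shown
  integrable: as a supremum of continuous functions it is lower semicontinuous, and superlinearity,
  assumed only pointwise in \<open>(q,t)\<close>, is locally uniform by convexity, so that \<open>L\<close> is locally
  bounded.\<close>

section \<open>Calculus of smooth maps\<close>

text \<open>The topology and the Borel sets of the extended phase space are given only through
  charts, so every analytic statement is pulled back to open subsets of Euclidean space, and open
  sets there are pushed forward again. Two obstacles shape the details. First, a real-valued
  \<open>SUP\<close> has its usual meaning only over a set that is bounded above. Fenchel's
  inequality therefore already rests on superlinearity, and comparing the dual norm of the metric
  with the Euclidean norm of coordinates first requires the unit ball of the metric to be bounded.
  Second, superlinearity and positivity of the Hessian are stated on the fibres, while local bounds
  need uniformity in the base point; both are first rewritten for the coordinate expression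
  \<open>ham\<close>, where joint continuity in base point, covector and time is available.
  Measurability is always tested on superlevel sets \<open>a < f\<close>, since suprema of
  continuous functions, and also \<open>frac\<close>, have open superlevel sets without being known,
  or without being able, to be continuous.\<close>

lemma times_differentiable_on_cong:
  assumes "open S" "\<And>x. x \<in> S \<Longrightarrow> f x = g x"
  shows "times_differentiable_on k S f \<longleftrightarrow> times_differentiable_on k S g"
  using assms(2)
proof (induction k arbitrary: f g)
  case 0
  then show ?case by (simp cong: continuous_on_cong)
next
  case (Suc k)
  have diff: "f differentiable at x \<longleftrightarrow> g differentiable at x" if "x \<in> S" for x
    unfolding differentiable_def
    using has_derivative_transform_within_open[OF _ assms(1) that, of f _ UNIV g]
      has_derivative_transform_within_open[OF _ assms(1) that, of g _ UNIV f] Suc.prems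
    by auto
  show ?case
  proof (cases "\<forall>x\<in>S. f differentiable at x")
    case True
    then have "frechet_derivative f (at x) = frechet_derivative g (at x)" if "x \<in> S" for x
      using frechet_derivative_transform_within_open[OF _ assms(1) that] Suc.prems that by blast
    then have "times_differentiable_on k S (\<lambda>x. frechet_derivative f (at x) v) \<longleftrightarrow>
        times_differentiable_on k S (\<lambda>x. frechet_derivative g (at x) v)" for v
      by (intro Suc.IH) simp
    with diff show ?thesis by simp
  next
    case False
    with diff show ?thesis by auto
  qed
qed

lemma frechet_derivative_add:
  assumes "f differentiable at x" "g differentiable at x"
  shows "frechet_derivative (\<lambda>x. f x + g x) (at x) =
    (\<lambda>v. frechet_derivative f (at x) v + frechet_derivative g (at x) v)"
  using assms by (intro frechet_derivative_at[symmetric] has_derivative_add)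
    (simp_all flip: frechet_derivative_works)

lemma frechet_derivative_minus:
  assumes "f differentiable at x"
  shows "frechet_derivative (\<lambda>x. - f x) (at x) = (\<lambda>v. - frechet_derivative f (at x) v)"
  using assms by (intro frechet_derivative_at[symmetric] has_derivative_minus)
    (simp flip: frechet_derivative_works)

text \<open>The derivative of the sum splits only at points of \<open>S\<close>, so the recursion
  passes through \<open>times_differentiable_on_cong\<close>, for which \<open>S\<close> has to be
  open. Sums and negatives of primitives later yield transitivity and symmetry of
  \<open>cohomologous\<close>.\<close>

lemma times_differentiable_on_add:
  assumes "open S" "times_differentiable_on k S f" "times_differentiable_on k S g"
  shows "times_differentiable_on k S (\<lambda>x. f x + g x)"
  using assms(2,3)
proof (induction k arbitrary: f g)
  case 0
  then show ?case by (simp add: continuous_on_add)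
next
  case (Suc k)
  have "times_differentiable_on k S (\<lambda>x. frechet_derivative (\<lambda>x. f x + g x) (at x) v)" for v
    using Suc.prems Suc.IH[of "\<lambda>x. frechet_derivative f (at x) v" "\<lambda>x. frechet_derivative g (at x) v"]
    by (subst times_differentiable_on_cong[OF assms(1), where
        g = "\<lambda>x. frechet_derivative f (at x) v + frechet_derivative g (at x) v"])
      (simp_all add: frechet_derivative_add)
  with Suc.prems show ?case by simp
qed

lemma times_differentiable_on_minus:
  assumes "open S" "times_differentiable_on k S f"
  shows "times_differentiable_on k S (\<lambda>x. - f x)"
  using assms(2)
proof (induction k arbitrary: f)
  case 0
  then show ?case by (simp add: continuous_on_minus)
next
  case (Suc k)
  have "times_differentiable_on k S (\<lambda>x. frechet_derivative (\<lambda>x. - f x) (at x) v)" for v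
    using Suc.prems Suc.IH[of "\<lambda>x. frechet_derivative f (at x) v"]
    by (subst times_differentiable_on_cong[OF assms(1), where
        g = "\<lambda>x. - frechet_derivative f (at x) v"])
      (simp_all add: frechet_derivative_minus)
  with Suc.prems show ?case by simp
qed

lemma smooth_on_add:
  "open S \<Longrightarrow> smooth_on S f \<Longrightarrow> smooth_on S g \<Longrightarrow> smooth_on S (\<lambda>x. f x + g x)"
  unfolding smooth_on_def by (simp add: times_differentiable_on_add)

lemma smooth_on_minus: "open S \<Longrightarrow> smooth_on S f \<Longrightarrow> smooth_on S (\<lambda>x. - f x)"
  unfolding smooth_on_def by (simp add: times_differentiable_on_minus)

lemma smooth_on_imp_continuous_on: "smooth_on S f \<Longrightarrow> continuous_on S f"
  unfolding smooth_on_def by (metis times_differentiable_on.simps(1))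

lemma smooth_on_imp_differentiable: "smooth_on S f \<Longrightarrow> x \<in> S \<Longrightarrow> f differentiable at x"
  unfolding smooth_on_def by (metis times_differentiable_on.simps(2))

lemma smooth_on_frechet_derivative:
  "smooth_on S f \<Longrightarrow> smooth_on S (\<lambda>x. frechet_derivative f (at x) v)"
  unfolding smooth_on_def by (metis times_differentiable_on.simps(2))

text \<open>Smoothness gives continuity in \<open>x\<close> for each fixed direction only. Expanding
  \<open>y\<close> in the finite basis turns this into joint continuity, as required for the tangent
  maps of the transitions.\<close>

lemma continuous_on_frechet_derivative:
  fixes f :: "'a::euclidean_space \<Rightarrow> 'b::real_normed_vector"
  assumes "smooth_on S f"
  shows "continuous_on (S \<times> UNIV) (\<lambda>(x, y). frechet_derivative f (at x) y)"
proof -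
  have "frechet_derivative f (at x) y = (\<Sum>b\<in>Basis. (y \<bullet> b) *\<^sub>R frechet_derivative f (at x) b)"
    if "x \<in> S" for x y
  proof -
    have "linear (frechet_derivative f (at x))"
      using smooth_on_imp_differentiable[OF assms that] by (rule linear_frechet_derivative)
    then show ?thesis
      by (subst euclidean_representation[of y, symmetric]) (simp add: linear_sum linear_scale)
  qed
  then have "continuous_on (S \<times> UNIV) (\<lambda>(x, y). frechet_derivative f (at x) y) \<longleftrightarrow>
      continuous_on (S \<times> UNIV) (\<lambda>z. \<Sum>b\<in>Basis. (snd z \<bullet> b) *\<^sub>R frechet_derivative f (at (fst z)) b)"
    by (intro continuous_on_cong) auto
  moreover have "continuous_on (S \<times> UNIV) (\<lambda>z. frechet_derivative f (at (fst z)) b)" for b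
    by (rule continuous_on_compose2[OF smooth_on_imp_continuous_on[OF
          smooth_on_frechet_derivative[OF assms]] continuous_on_fst[OF continuous_on_id]]) auto
  then have "continuous_on (S \<times> UNIV)
      (\<lambda>z. \<Sum>b\<in>Basis. (snd z \<bullet> b) *\<^sub>R frechet_derivative f (at (fst z)) b)"
    by (intro continuous_intros)
  ultimately show ?thesis
    by simp
qed

section \<open>Fibrewise convex functions\<close>

text \<open>A convexity inequality involves two points and hence one line. This is the form in which
  a condition on second derivatives along lines can be used.\<close>

lemma convex_on_UNIV_lines:
  fixes f :: "'a::real_vector \<Rightarrow> real"
  assumes "\<And>x v. convex_on UNIV (\<lambda>s::real. f (x + s *\<^sub>R v))"
  shows "convex_on UNIV f"
  unfolding convex_on_def
proof (intro conjI ballI allI impI)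
  fix x y :: 'a and u v :: real
  assume uv: "u \<ge> 0" "v \<ge> 0" "u + v = 1"
  have "f (x + (u *\<^sub>R 0 + v *\<^sub>R 1) *\<^sub>R (y - x)) \<le> u * f (x + 0 *\<^sub>R (y - x)) + v * f (x + 1 *\<^sub>R (y - x))"
    using assms[of x "y - x"] uv unfolding convex_on_def by blast
  moreover have "x + v *\<^sub>R (y - x) = u *\<^sub>R x + v *\<^sub>R y"
    using uv by (simp add: algebra_simps flip: scaleR_add_left)
  ultimately show "f (u *\<^sub>R x + v *\<^sub>R y) \<le> u * f x + v * f y"
    by simp
qed simp

text \<open>Strict dominance of \<open>r |\<eta>|\<close> on one sphere persists for nearby fibres by compactness, and
  convexity along rays propagates it to the outside of the sphere.\<close>

lemma locally_bounded_fenchel: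
  fixes h :: "'a::topological_space \<Rightarrow> 'b::euclidean_space \<Rightarrow> real"
  assumes "open S" "z0 \<in> S"
    and cont: "continuous_on (S \<times> UNIV) (\<lambda>(z, \<eta>). h z \<eta>)"
    and convex: "\<And>z. z \<in> S \<Longrightarrow> convex_on UNIV (h z)"
    and super: "\<And>K. \<exists>R. \<forall>\<eta>. norm \<eta> \<ge> R \<longrightarrow> h z0 \<eta> \<ge> K * norm \<eta>"
  shows "\<exists>N B. open N \<and> z0 \<in> N \<and> N \<subseteq> S \<and>
    (\<forall>z\<in>N. \<forall>\<eta> y. norm y \<le> r \<longrightarrow> \<eta> \<bullet> y - h z \<eta> \<le> B)"
proof -
  define \<rho> where "\<rho> = max r 0"
  have \<rho>: "\<rho> \<ge> 0" "r \<le> \<rho>" by (auto simp: \<rho>_def)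
  \<comment> \<open>The slope is chosen so that on a sphere of radius \<open>R \<ge> 1\<close> the
    value exceeds \<open>h z0 0 + \<rho> * R\<close> strictly: the middle summand absorbs
    \<open>h z0 0\<close>, and the summand \<open>1\<close> gives the strictness that survives a
    change of fibre.\<close>
  obtain R0 where R0: "\<And>\<eta>. norm \<eta> \<ge> R0 \<Longrightarrow> h z0 \<eta> \<ge> (\<rho> + \<bar>h z0 0\<bar> + 1) * norm \<eta>"
    using super by blast
  define R where "R = max R0 1"
  have R: "R \<ge> 1" "R \<ge> R0" by (auto simp: R_def)
  have open_SU: "open (S \<times> (UNIV :: 'b set))"
    using assms(1) by (simp add: open_Times)
  have cont0: "continuous_on (S \<times> UNIV) (\<lambda>p::'a \<times> 'b. h (fst p) 0)"
    by (rule continuous_on_compose2[OF cont, where f = "\<lambda>p. (fst p, 0)", simplified])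
      (auto intro!: continuous_intros)
  have cont': "continuous_on (S \<times> UNIV) (\<lambda>p. h (fst p) (snd p))"
    using cont by (simp add: case_prod_unfold)
  have cont_z0: "continuous_on UNIV (h z0)"
    by (rule continuous_on_compose2[OF cont, where f = "\<lambda>\<eta>. (z0, \<eta>)", simplified])
      (use assms(2) in \<open>auto intro!: continuous_intros\<close>)
  obtain \<eta>0 where m: "\<And>\<eta>. \<eta> \<in> cball 0 R \<Longrightarrow> h z0 \<eta>0 \<le> h z0 \<eta>"
    using continuous_attains_inf[OF compact_cball _ continuous_on_subset[OF cont_z0 subset_UNIV]] R
    by (metis cball_eq_empty not_less order_trans zero_le_one)
  define m where "m = h z0 \<eta>0"
  \<comment> \<open>\<open>W1\<close> records growth on the sphere relative to the value at
    \<open>0\<close> of the same fibre; \<open>W2\<close> records a lower bound on the whole ball,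
    with \<open>1\<close> subtracted from the minimum \<open>m\<close> to make it strict. Both are
    open, so the tube lemma extends them from \<open>z0\<close> to a neighbourhood.\<close>
  define W1 where "W1 = (S \<times> UNIV) \<inter> (\<lambda>p. h (fst p) (snd p) - h (fst p) 0) -` {\<rho> * R <..}"
  define W2 where "W2 = (S \<times> UNIV) \<inter> (\<lambda>p::'a \<times> 'b. h (fst p) (snd p)) -` {m - 1 <..}"
  have "open W1" unfolding W1_def
    by (intro continuous_open_preimage continuous_intros cont' cont0 open_SU open_greaterThan)
  moreover have "{z0} \<times> sphere 0 R \<subseteq> W1"
  proof -
    have "h z0 \<eta> - h z0 0 > \<rho> * R" if "norm \<eta> = R" for \<eta>
    proof -
      have "\<bar>h z0 0\<bar> * 1 \<le> \<bar>h z0 0\<bar> * R"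
        using R by (intro mult_left_mono) auto
      moreover have "h z0 \<eta> \<ge> \<rho> * R + \<bar>h z0 0\<bar> * R + R"
        using R0[of \<eta>] that R by (simp add: algebra_simps)
      ultimately show ?thesis
        using R by linarith
    qed
    then show ?thesis using assms(2) by (auto simp: W1_def)
  qed
  ultimately obtain N1 where N1: "z0 \<in> N1" "open N1" "N1 \<times> sphere 0 R \<subseteq> W1"
    using Elementary_Topology.tube_lemma[OF compact_sphere] by metis
  have "open W2" unfolding W2_def
    by (intro continuous_open_preimage cont' open_SU open_greaterThan)
  moreover have "{z0} \<times> cball 0 R \<subseteq> W2"
    using m assms(2) by (force simp: W2_def m_def)
  ultimately obtain N2 where N2: "z0 \<in> N2" "open N2" "N2 \<times> cball 0 R \<subseteq> W2"
    using Elementary_Topology.tube_lemma[OF compact_cball] by metis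
  have "\<eta> \<bullet> y - h z \<eta> \<le> \<rho> * R + 1 - m" if z: "z \<in> N1 \<inter> N2 \<inter> S" and y: "norm y \<le> r" for z \<eta> y
  proof -
    have ip: "\<eta> \<bullet> y \<le> \<rho> * norm \<eta>"
    proof -
      have "\<eta> \<bullet> y \<le> norm \<eta> * norm y" by (rule norm_cauchy_schwarz)
      also have "\<dots> \<le> norm \<eta> * \<rho>" using y \<rho> by (intro mult_left_mono) auto
      finally show ?thesis by (simp add: mult.commute)
    qed
    show ?thesis
    proof (cases "norm \<eta> \<le> R")
      case True
      then have "(z, \<eta>) \<in> W2" using N2 z by auto
      then have "h z \<eta> > m - 1" by (simp add: W2_def)
      moreover have "\<rho> * norm \<eta> \<le> \<rho> * R" using True \<rho> by (intro mult_left_mono) auto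
      ultimately show ?thesis using ip by linarith
    next
      case False
      \<comment> \<open>Scaling by \<open>l\<close> brings \<open>\<eta>\<close> back to the sphere.
        Convexity on the segment from \<open>0\<close> to \<open>\<eta>\<close> then bounds the
        increment at \<open>\<eta>\<close> below by \<open>1 / l\<close> times the increment on the
        sphere.\<close>
      define l where "l = R / norm \<eta>"
      have \<eta>_pos: "0 < norm \<eta>" using False R by linarith
      then have l: "0 < l" "l < 1" using False R by (simp_all add: l_def)
      have "(z, l *\<^sub>R \<eta>) \<in> W1"
        using N1 z R \<eta>_pos by (intro subsetD[OF N1(3)]) (simp add: l_def)
      then have 1: "h z (l *\<^sub>R \<eta>) - h z 0 > \<rho> * R" by (simp add: W1_def)
      have "h z ((1 - l) *\<^sub>R 0 + l *\<^sub>R \<eta>) \<le> (1 - l) * h z 0 + l * h z \<eta>"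
        using convex_onD[OF convex, of z l 0 \<eta>] z l by simp
      then have "l * (h z \<eta> - h z 0) > \<rho> * R" using 1 by (simp add: algebra_simps)
      moreover have "\<rho> * R = l * (\<rho> * norm \<eta>)" using False R by (auto simp: l_def)
      ultimately have "l * (\<rho> * norm \<eta>) < l * (h z \<eta> - h z 0)" by simp
      then have "h z \<eta> - h z 0 > \<rho> * norm \<eta>" using l(1) by (rule mult_left_less_imp_less[OF _ less_imp_le])
      moreover have "(z, 0) \<in> W2" using N2 z R by auto
      then have "h z 0 > m - 1" by (simp add: W2_def)
      moreover have "\<rho> * R \<ge> 0" using \<rho> R by simp
      ultimately show ?thesis using ip by linarith
    qed
  qed
  then show ?thesis
    using N1 N2 assms(1,2)
    by (intro exI[of _ "N1 \<inter> N2 \<inter> S"] exI[of _ "\<rho> * R + 1 - m"]) auto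
qed

section \<open>Averaging over the circle\<close>

lemma integrable_on_bounded_borel:
  fixes f :: "real \<Rightarrow> real"
  assumes "f \<in> borel_measurable borel" "\<And>x. \<bar>f x\<bar> \<le> B"
  shows "set_integrable lborel {a..b} f"
  unfolding set_integrable_def
proof (rule integrableI_bounded_set[where A = "{a..b}" and B = B])
  show "(\<lambda>x. indicator {a..b} x *\<^sub>R f x) \<in> borel_measurable lborel"
    using assms(1) by measurable
qed (use assms(2) in \<open>auto simp: indicator_def emeasure_lborel_Icc_eq intro: order_trans[OF abs_ge_zero]\<close>)

lemma integral_periodic_shift:
  fixes f :: "real \<Rightarrow> real"
  assumes "\<And>a b. f integrable_on {a..b}" "\<And>x. f (x + 1) = f x" "0 \<le> a" "a \<le> 1"
  shows "integral {0..1} (\<lambda>s. f (a + s)) = integral {0..1} f"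
proof -
  have "integral {0..1} (\<lambda>s. f (a + s)) = integral {a..1 + a} f"
    using integral_shift_Icc_real[of 0 1 f a] by (simp add: o_def)
  also have "\<dots> = integral {a..1} f + integral {1..1 + a} f"
    using assms by (intro Henstock_Kurzweil_Integration.integral_combine[symmetric]) auto
  also have "integral {1..1 + a} f = integral {0..a} f"
    using integral_shift_Icc_real[of 0 a f 1] assms(2) by (simp add: o_def add.commute)
  also have "integral {a..1} f + integral {0..a} f = integral {0..1} f"
    using assms Henstock_Kurzweil_Integration.integral_combine[of 0 a 1 f] by simp
  finally show ?thesis .
qed

text \<open>Averaging the invariance over all shifts \<open>s\<close> in the unit interval and
  exchanging the integrals leaves, for each \<open>z\<close>, the mean of \<open>f\<close> over one
  full period starting at \<open>X z\<close>, which does not depend on \<open>z\<close>.\<close>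

lemma (in prob_space) expectation_shift_invariant_periodic:
  fixes f :: "real \<Rightarrow> real"
  assumes X: "X \<in> borel_measurable M" "\<And>z. 0 \<le> X z \<and> X z \<le> 1"
    and f: "f \<in> borel_measurable borel" "\<And>x. \<bar>f x\<bar> \<le> B" "\<And>x. f (x + 1) = f x"
    and inv: "\<And>s. expectation (\<lambda>z. f (X z + s)) = expectation (\<lambda>z. f (X z))"
  shows "expectation (\<lambda>z. f (X z)) = integral {0..1} f"
proof -
  let ?U = "restrict_space lborel {0..1::real}"
  interpret U: prob_space ?U
    by (rule prob_spaceI) (simp add: space_restrict_space emeasure_restrict_space)
  interpret P: pair_prob_space M ?U ..
  have U_integral: "(\<integral>s. k s \<partial>?U) = integral {0..1} k"
    if "k \<in> borel_measurable borel" "\<And>x. \<bar>k x\<bar> \<le> B" for k :: "real \<Rightarrow> real"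
    using set_borel_integral_eq_integral(2)[OF integrable_on_bounded_borel[OF that]]
    by (simp add: integral_restrict_space set_lebesgue_integral_def)
  have f_int: "f integrable_on {a..b}" for a b
    by (rule set_borel_integral_eq_integral(1)[OF integrable_on_bounded_borel[OF f(1,2)]])
  have meas: "(\<lambda>p. f (X (fst p) + snd p)) \<in> borel_measurable (M \<Otimes>\<^sub>M ?U)"
  proof -
    have "snd \<in> M \<Otimes>\<^sub>M ?U \<rightarrow>\<^sub>M borel"
      by (rule measurable_compose[OF measurable_snd]) (simp add: measurable_restrict_space1)
    then show ?thesis
      using X(1) f(1) by measurable
  qed
  have int: "integrable (M \<Otimes>\<^sub>M ?U) (\<lambda>(z, s). f (X z + s))"
    using meas f(2) by (intro P.P.integrable_const_bound[where B = B]) (auto simp: case_prod_unfold)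
  have "expectation (\<lambda>z. f (X z)) = (\<integral>s. expectation (\<lambda>z. f (X z + s)) \<partial>?U)"
    using U.prob_space by (simp add: inv)
  also have "\<dots> = expectation (\<lambda>z. \<integral>s. f (X z + s) \<partial>?U)"
    by (rule P.Fubini_integral[OF int])
  also have "\<dots> = expectation (\<lambda>z. integral {0..1} f)"
    using X(2) f
    by (intro Bochner_Integration.integral_cong refl)
      (simp add: U_integral integral_periodic_shift[OF f_int])
  finally show ?thesis by (simp add: prob_space)
qed

section \<open>Coordinates on the tangent and cotangent bundle\<close>

locale atlas =
  fixes A :: "('m::topological_space, 'n::finite) chart set"
  assumes smooth_atlas: "smooth_atlas A"
begin

lemma is_chart: "c \<in> A \<Longrightarrow> is_chart c"
  using smooth_atlas unfolding smooth_atlas_def by blast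

lemma open_dom: "c \<in> A \<Longrightarrow> open (dom_of c)"
  using is_chart unfolding is_chart_def by blast

lemma open_img: "c \<in> A \<Longrightarrow> open (img_of c)"
  using is_chart unfolding is_chart_def by blast

lemma homeomorphism: "c \<in> A \<Longrightarrow> homeomorphism (dom_of c) (img_of c) (coord c) (point c)"
  using is_chart unfolding is_chart_def by blast

lemma coord_in_img: "q \<in> dom_of c \<Longrightarrow> coord c q \<in> img_of c"
  by (simp add: img_of_def)

lemma point_coord: "c \<in> A \<Longrightarrow> q \<in> dom_of c \<Longrightarrow> point c (coord c q) = q"
  using homeomorphism unfolding homeomorphism_def by blast

lemma coord_point: "c \<in> A \<Longrightarrow> x \<in> img_of c \<Longrightarrow> coord c (point c x) = x"
  using homeomorphism unfolding homeomorphism_def by blast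

lemma point_in_dom: "c \<in> A \<Longrightarrow> x \<in> img_of c \<Longrightarrow> point c x \<in> dom_of c"
  using homeomorphism unfolding homeomorphism_def by blast

lemma continuous_on_coord: "c \<in> A \<Longrightarrow> continuous_on (dom_of c) (coord c)"
  using homeomorphism unfolding homeomorphism_def by blast

lemma continuous_on_point: "c \<in> A \<Longrightarrow> continuous_on (img_of c) (point c)"
  using homeomorphism unfolding homeomorphism_def by blast

lemma chart_around: obtains c where "c \<in> A" "q \<in> dom_of c"
  using smooth_atlas unfolding smooth_atlas_def by blast

lemma overlap_eq:
  "c \<in> A \<Longrightarrow> coord c ` (dom_of c \<inter> dom_of d) = img_of c \<inter> point c -` dom_of d"
  by (force simp: point_coord coord_in_img coord_point point_in_dom image_iff)

lemma open_overlap: "c \<in> A \<Longrightarrow> d \<in> A \<Longrightarrow> open (coord c ` (dom_of c \<inter> dom_of d))"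
  unfolding overlap_eq by (intro continuous_open_preimage continuous_on_point open_img open_dom)

lemma smooth_transition:
  "c \<in> A \<Longrightarrow> d \<in> A \<Longrightarrow> smooth_on (coord c ` (dom_of c \<inter> dom_of d)) (transition c d)"
  using smooth_atlas unfolding smooth_atlas_def by blast

abbreviation jacobian where
  "jacobian c d q \<equiv> frechet_derivative (transition c d) (at (coord c q))"

lemma has_derivative_transition:
  assumes "c \<in> A" "d \<in> A" "q \<in> dom_of c" "q \<in> dom_of d"
  shows "(transition c d has_derivative jacobian c d q) (at (coord c q))"
  using smooth_on_imp_differentiable[OF smooth_transition[OF assms(1,2)]] assms
  by (simp flip: frechet_derivative_works)

lemma transition_coord: "c \<in> A \<Longrightarrow> q \<in> dom_of c \<Longrightarrow> transition c d (coord c q) = coord d q"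
  by (simp add: transition_def point_coord)

lemma jacobian_self:
  assumes "c \<in> A" "q \<in> dom_of c"
  shows "jacobian c c q y = y"
proof -
  have "(transition c c has_derivative (\<lambda>y. y)) (at (coord c q))"
    by (rule has_derivative_transform_within_open[OF has_derivative_ident open_img[OF assms(1)]])
      (use assms in \<open>auto simp: coord_in_img transition_def coord_point\<close>)
  then show ?thesis
    by (simp flip: frechet_derivative_at)
qed

lemma jacobian_chain:
  assumes "c \<in> A" "d \<in> A" "e \<in> A" "q \<in> dom_of c" "q \<in> dom_of d" "q \<in> dom_of e"
  shows "jacobian d e q (jacobian c d q y) = jacobian c e q y"
proof -
  have "(transition d e \<circ> transition c d has_derivative jacobian d e q \<circ> jacobian c d q)
      (at (coord c q))"
    using has_derivative_transition[of c d q] has_derivative_transition[of d e q] assms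
    by (intro diff_chain_at) (simp_all add: transition_coord)
  then have "(transition c e has_derivative jacobian d e q \<circ> jacobian c d q) (at (coord c q))"
    by (rule has_derivative_transform_within_open[OF _ open_overlap[OF assms(1,2)]])
      (use assms in \<open>auto simp: transition_coord\<close>)
  then show ?thesis
    by (metis comp_apply frechet_derivative_at)
qed

lemma linear_jacobian:
  assumes "c \<in> A" "d \<in> A" "q \<in> dom_of c" "q \<in> dom_of d"
  shows "linear (jacobian c d q)"
  using has_derivative_transition[OF assms] by (rule has_derivative_linear)

section \<open>Coordinates of tangent vectors and covectors at a point\<close>

lemma tangent_vector_in:
  assumes "c \<in> A" "q \<in> dom_of c"
  shows "tangent_vector A c q y \<in> tangent_space A q"
  unfolding tangent_space_def mem_Collect_eq
proof (intro conjI ballI allI impI)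
  fix d e assume "d \<in> A" "e \<in> A" "q \<in> dom_of d \<and> q \<in> dom_of e"
  then show "tangent_vector A c q y e = jacobian d e q (tangent_vector A c q y d)"
    using jacobian_chain[of c d e q y] assms by (simp add: tangent_vector_def)
qed (auto simp: tangent_vector_def)

lemma tangent_vector_coord:
  "c \<in> A \<Longrightarrow> q \<in> dom_of c \<Longrightarrow> tangent_vector A c q y c = y"
  by (simp add: tangent_vector_def jacobian_self)

lemma tangent_vector_of_coord:
  assumes "c \<in> A" "q \<in> dom_of c" "X \<in> tangent_space A q"
  shows "tangent_vector A c q (X c) = X"
proof
  fix d
  show "tangent_vector A c q (X c) d = X d"
  proof (cases "d \<in> A \<and> q \<in> dom_of d")
    case True
    then have "X d = jacobian c d q (X c)"
      using assms unfolding tangent_space_def by blast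
    with True show ?thesis
      by (simp add: tangent_vector_def)
  next
    case False
    then have "X d = 0"
      using assms unfolding tangent_space_def by blast
    with False show ?thesis
      by (auto simp: tangent_vector_def)
  qed
qed

lemma tangent_vector_linear:
  assumes "c \<in> A" "q \<in> dom_of c"
  shows "tangent_vector A c q (a *\<^sub>R y + b *\<^sub>R z) =
    (\<lambda>d. a *\<^sub>R tangent_vector A c q y d + b *\<^sub>R tangent_vector A c q z d)"
proof
  fix d
  show "tangent_vector A c q (a *\<^sub>R y + b *\<^sub>R z) d =
      a *\<^sub>R tangent_vector A c q y d + b *\<^sub>R tangent_vector A c q z d"
    using linear_jacobian[of c d q] assms
    by (auto simp: tangent_vector_def linear_add linear_scale)
qed

lemma linear_on_tangent_coords:
  assumes "c \<in> A" "q \<in> dom_of c" "linear_on_tangent A q p"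
  shows "linear (\<lambda>y. p (tangent_vector A c q y))"
proof (rule linearI)
  have p: "p (tangent_vector A c q (a *\<^sub>R y + b *\<^sub>R z)) =
      a * p (tangent_vector A c q y) + b * p (tangent_vector A c q z)" for a b y z
    using assms tangent_vector_in[OF assms(1,2)]
    unfolding tangent_vector_linear[OF assms(1,2)] linear_on_tangent_def by blast
  show "p (tangent_vector A c q (y + z)) = p (tangent_vector A c q y) + p (tangent_vector A c q z)" for y z
    using p[of 1 y 1 z] by simp
  show "p (tangent_vector A c q (r *\<^sub>R y)) = r *\<^sub>R p (tangent_vector A c q y)" for r y
    using p[of r y 0 0] by simp
qed

lemma tangent_space_combination:
  assumes "X \<in> tangent_space A q" "Y \<in> tangent_space A q"
  shows "(\<lambda>d. a *\<^sub>R X d + b *\<^sub>R Y d) \<in> tangent_space A q"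
proof -
  obtain c where c: "c \<in> A" "q \<in> dom_of c" by (rule chart_around)
  show ?thesis
    using tangent_vector_in[OF c, of "a *\<^sub>R X c + b *\<^sub>R Y c"] tangent_vector_linear[OF c]
      tangent_vector_of_coord[OF c] assms by simp
qed

lemma cotangent_vector_in:
  "cotangent_vector A c q y \<in> cotangent_space A q"
  by (auto simp: cotangent_space_def cotangent_vector_def linear_on_tangent_def
      tangent_space_combination inner_add_right)

lemma cotangent_vector_apply:
  "c \<in> A \<Longrightarrow> q \<in> dom_of c \<Longrightarrow> cotangent_vector A c q y (tangent_vector A c q z) = y \<bullet> z"
  by (simp add: cotangent_vector_def tangent_vector_in tangent_vector_coord)

lemma cotangent_vector_line:
  "(\<lambda>X. cotangent_vector A c q y X + s * cotangent_vector A c q z X) =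
    cotangent_vector A c q (y + s *\<^sub>R z)"
  by (auto simp: cotangent_vector_def inner_add_left)

lemma cotangent_vector_nonzero:
  assumes "c \<in> A" "q \<in> dom_of c" "y \<noteq> 0"
  shows "cotangent_vector A c q y \<noteq> (\<lambda>_. 0)"
  using cotangent_vector_apply[OF assms(1,2), of y y] assms(3) by (metis inner_eq_zero_iff)

text \<open>Linearity determines \<open>p\<close> on the tangent space by its values on the
  coordinate basis, and outside both sides are \<open>0\<close> by convention. Suprema over
  covectors thereby become suprema over \<open>real ^ 'n\<close>.\<close>

lemma cotangent_vector_of_coords:
  assumes "c \<in> A" "q \<in> dom_of c" "p \<in> cotangent_space A q"
  shows "cotangent_vector A c q (\<chi> i. p (tangent_vector A c q (axis i 1))) = p"
proof
  fix X
  show "cotangent_vector A c q (\<chi> i. p (tangent_vector A c q (axis i 1))) X = p X"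
  proof (cases "X \<in> tangent_space A q")
    case True
    interpret p: linear "\<lambda>y. p (tangent_vector A c q y)"
      using assms by (intro linear_on_tangent_coords) (auto simp: cotangent_space_def)
    have "p X = p (tangent_vector A c q (\<Sum>i\<in>UNIV. X c $ i *\<^sub>R axis i 1))"
      using tangent_vector_of_coord[OF assms(1,2) True] basis_expansion[of "X c"]
      by (simp add: scalar_mult_eq_scaleR)
    also have "\<dots> = (\<Sum>i\<in>UNIV. X c $ i * p (tangent_vector A c q (axis i 1)))"
      by (simp add: p.sum p.scale)
    finally show ?thesis
      using True by (simp add: cotangent_vector_def inner_vec_def mult.commute)
  next
    case False
    with assms show ?thesis by (simp add: cotangent_vector_def cotangent_space_def)
  qed
qed

lemma cotangent_space_eq:
  assumes "c \<in> A" "q \<in> dom_of c"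
  shows "cotangent_space A q = range (cotangent_vector A c q)"
proof
  show "cotangent_space A q \<subseteq> range (cotangent_vector A c q)"
    using cotangent_vector_of_coords[OF assms] by (metis rangeI subsetI)
qed (auto simp: cotangent_vector_in)

lemma form_coords_eq:
  assumes "c \<in> A" "q \<in> dom_of c" "\<theta> q \<in> cotangent_space A q"
  shows "\<theta> q = cotangent_vector A c q (form_coords A \<theta> c (coord c q))"
  using cotangent_vector_of_coords[OF assms] assms by (simp add: form_coords_def point_coord)

subsection \<open>Cohomologous forms\<close>

lemma closed_form_cotangent: "\<theta> \<in> closed_forms A \<Longrightarrow> \<theta> q \<in> cotangent_space A q"
  by (simp add: closed_forms_def)

lemma smooth_form_coords: "\<theta> \<in> closed_forms A \<Longrightarrow> c \<in> A \<Longrightarrow> smooth_on (img_of c) (form_coords A \<theta> c)"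
  by (simp add: closed_forms_def)

lemma smooth_function_differentiable:
  assumes "smooth_function A f" "c \<in> A" "q \<in> dom_of c"
  shows "(\<lambda>x. f (point c x)) differentiable at (coord c q)"
proof -
  have "smooth_on (img_of c) (\<lambda>x. f (point c x))"
    using assms(1,2) by (simp add: smooth_function_def comp_def)
  then show ?thesis
    using coord_in_img[OF assms(3)] by (rule smooth_on_imp_differentiable)
qed

lemma is_differentialD:
  assumes "is_differential A f \<theta>" "c \<in> A" "q \<in> dom_of c" "X \<in> tangent_space A q"
  shows "\<theta> q X = frechet_derivative (\<lambda>x. f (point c x)) (at (coord c q)) (X c)"
  using assms unfolding is_differential_def comp_def by blast

lemma cohomologous_sym:
  assumes "(\<omega>, \<theta>) \<in> cohomologous A"
  shows "(\<theta>, \<omega>) \<in> cohomologous A"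
proof -
  obtain f where f: "smooth_function A f" "is_differential A f (\<lambda>q X. \<theta> q X - \<omega> q X)"
    and closed: "\<omega> \<in> closed_forms A" "\<theta> \<in> closed_forms A"
    using assms by (auto simp: cohomologous_def)
  have "smooth_function A (\<lambda>q. - f q)"
    using f(1) by (simp add: smooth_function_def comp_def smooth_on_minus open_img)
  moreover have "is_differential A (\<lambda>q. - f q) (\<lambda>q X. \<omega> q X - \<theta> q X)"
    unfolding is_differential_def
  proof (intro ballI)
    fix c q X assume *: "c \<in> A" "q \<in> dom_of c" "X \<in> tangent_space A q"
    show "\<omega> q X - \<theta> q X =
        frechet_derivative ((\<lambda>q. - f q) \<circ> point c) (at (coord c q)) (X c)"
      unfolding comp_def frechet_derivative_minus[OF smooth_function_differentiable[OF f(1) *(1,2)]]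
      using is_differentialD[OF f(2) *] by simp
  qed
  ultimately show ?thesis
    using closed by (auto simp: cohomologous_def)
qed

lemma cohomologous_trans:
  assumes "(\<omega>, \<theta>) \<in> cohomologous A" "(\<theta>, \<xi>) \<in> cohomologous A"
  shows "(\<omega>, \<xi>) \<in> cohomologous A"
proof -
  obtain f g where f: "smooth_function A f" "is_differential A f (\<lambda>q X. \<theta> q X - \<omega> q X)"
    and g: "smooth_function A g" "is_differential A g (\<lambda>q X. \<xi> q X - \<theta> q X)"
    and closed: "\<omega> \<in> closed_forms A" "\<xi> \<in> closed_forms A"
    using assms by (auto simp: cohomologous_def)
  have "smooth_function A (\<lambda>q. f q + g q)"
    using f(1) g(1) by (simp add: smooth_function_def comp_def smooth_on_add open_img)
  moreover have "is_differential A (\<lambda>q. f q + g q) (\<lambda>q X. \<xi> q X - \<omega> q X)"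
    unfolding is_differential_def
  proof (intro ballI)
    fix c q X assume *: "c \<in> A" "q \<in> dom_of c" "X \<in> tangent_space A q"
    show "\<xi> q X - \<omega> q X =
        frechet_derivative ((\<lambda>q. f q + g q) \<circ> point c) (at (coord c q)) (X c)"
      unfolding comp_def frechet_derivative_add[OF smooth_function_differentiable[OF f(1) *(1,2)]
          smooth_function_differentiable[OF g(1) *(1,2)]]
      using is_differentialD[OF f(2) *] is_differentialD[OF g(2) *] by simp
  qed
  ultimately show ?thesis
    using closed by (auto simp: cohomologous_def)
qed

text \<open>\<open>pairing\<close> chooses a representative of the class. Because any \<theta> in
  \<open>C\<close> generates the very same set, the choice made for \<open>C\<close> is also the one
  made for the class of \<theta>, so the rotation vector condition for \<theta> speaks about
  \<open>pairing A C h\<close>.\<close>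

lemma de_rham_class_eq:
  assumes "C \<in> de_rham_H1 A" "\<theta> \<in> C"
  shows "\<theta> \<in> closed_forms A" "C = cohomologous A `` {\<theta>}"
proof -
  obtain \<omega> where \<omega>: "C = cohomologous A `` {\<omega>}"
    using assms(1) unfolding de_rham_H1_def by (rule quotientE)
  then have \<theta>: "(\<omega>, \<theta>) \<in> cohomologous A" using assms(2) by simp
  then show "\<theta> \<in> closed_forms A" unfolding cohomologous_def by simp
  show "C = cohomologous A `` {\<theta>}"
    unfolding \<omega>
  proof (intro equalityI subsetI)
    fix \<xi> assume "\<xi> \<in> cohomologous A `` {\<omega>}"
    then show "\<xi> \<in> cohomologous A `` {\<theta>}"
      using cohomologous_trans[OF cohomologous_sym[OF \<theta>]] by simp
  next
    fix \<xi> assume "\<xi> \<in> cohomologous A `` {\<theta>}"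
    then show "\<xi> \<in> cohomologous A `` {\<omega>}"
      using cohomologous_trans[OF \<theta>] by simp
  qed
qed

end

section \<open>The extended phase space\<close>

lemma abs_rep_circle: "abs_circle (rep_circle \<tau>) = \<tau>"
  by (rule Quotient3_abs_rep[OF Quotient3_circle])

lemma abs_circle_add_1: "abs_circle (t + 1) = abs_circle t"
  by (simp add: circle.abs_eq_iff)

lemma rep_abs_circle: "rep_circle (abs_circle t) - t \<in> \<int>"
  using abs_rep_circle[of "abs_circle t"] by (simp add: circle.abs_eq_iff)

lemma frac_eq_if_diff_Ints:
  assumes "s - t \<in> \<int>"
  shows "frac s = frac (t::real)"
proof -
  obtain n :: int where "s = t + of_int n"
    using assms by (metis Ints_cases add.commute diff_add_cancel)
  then show ?thesis by (simp add: frac_def)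
qed

lemma abs_circle_frac_add: "abs_circle (frac t + s) = abs_circle (t + s)"
  by (simp add: circle.abs_eq_iff frac_def)

text \<open>The saturation of \<open>V\<close> is the union of its integer translates, so the
  quotient map is open.\<close>

lemma open_abs_circle_image:
  assumes "open V"
  shows "open (abs_circle ` V)"
proof -
  have "abs_circle -` (abs_circle ` V) = (\<Union>n\<in>\<int>. (+) n ` V)"
  proof (intro equalityI subsetI)
    fix t assume "t \<in> abs_circle -` (abs_circle ` V)"
    then obtain s where "s \<in> V" "t - s \<in> \<int>" by (auto simp: circle.abs_eq_iff)
    then show "t \<in> (\<Union>n\<in>\<int>. (+) n ` V)"
      by (intro UN_I[of "t - s"] image_eqI[of _ _ s]) auto
  next
    fix t assume "t \<in> (\<Union>n\<in>\<int>. (+) n ` V)"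
    then obtain n s where "n \<in> \<int>" "s \<in> V" "t = n + s" by blast
    then have "abs_circle t = abs_circle s" by (simp add: circle.abs_eq_iff)
    with \<open>s \<in> V\<close> show "t \<in> abs_circle -` (abs_circle ` V)" by simp
  qed
  then show ?thesis
    unfolding open_circle_def using assms by (auto intro: open_translation)
qed

text \<open>At an integer \<open>frac\<close> drops from values near \<open>1\<close> to
  \<open>0\<close>, so it is lower semicontinuous although discontinuous. This makes the time
  coordinate accessible to the measurability criterion by superlevel sets.\<close>

lemma open_frac_greater: "open {t::real. a < frac t}"
proof (cases "a < 0")
  case True
  then have "{t::real. a < frac t} = UNIV"
    using frac_ge_0 by (auto intro: less_le_trans)
  then show ?thesis by simp
next
  case False
  have "{t::real. a < frac t} = (\<Union>n::int. {of_int n + a<..<of_int n + 1})"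
  proof (intro equalityI subsetI)
    fix t :: real assume "t \<in> {t. a < frac t}"
    then have "t \<in> {of_int \<lfloor>t\<rfloor> + a<..<of_int \<lfloor>t\<rfloor> + 1}"
      using frac_lt_1[of t] by (simp add: frac_def)
    then show "t \<in> (\<Union>n::int. {of_int n + a<..<of_int n + 1})" by blast
  next
    fix t assume "t \<in> (\<Union>n::int. {of_int n + a<..<of_int n + 1})"
    then obtain n :: int where n: "of_int n + a < t" "t < of_int n + 1" by auto
    then have "\<lfloor>t\<rfloor> = n" using False by (intro floor_unique) auto
    then show "t \<in> {t. a < frac t}" using n by (simp add: frac_def)
  qed
  then show ?thesis by (simp add: open_UN)
qed

context atlas
begin

definition tangent_point :: "('m, 'n) chart \<Rightarrow> (real ^ 'n) \<times> (real ^ 'n) \<Rightarrow> 'm \<times> ('m, 'n) tvec" where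
  "tangent_point c w = (point c (fst w), tangent_vector A c (point c (fst w)) (snd w))"

text \<open>Time runs over all of \<real>, so this map is not injective. The criteria below rest on
  its carrying open sets to open sets, and on these images covering the space.\<close>

definition phase_point ::
    "('m, 'n) chart \<Rightarrow> ((real ^ 'n) \<times> (real ^ 'n)) \<times> real \<Rightarrow> ('m \<times> ('m, 'n) tvec) \<times> circle" where
  "phase_point c w = (tangent_point c (fst w), abs_circle (snd w))"

definition phase_dom :: "('m, 'n) chart \<Rightarrow> (((real ^ 'n) \<times> (real ^ 'n)) \<times> real) set" where
  "phase_dom c = (img_of c \<times> UNIV) \<times> UNIV"

lemma open_phase_dom: "c \<in> A \<Longrightarrow> open (phase_dom c)"
  by (simp add: phase_dom_def open_Times open_img)

lemma tangent_point_in: "c \<in> A \<Longrightarrow> fst w \<in> img_of c \<Longrightarrow> tangent_point c w \<in> tangent_bundle A"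
  by (simp add: tangent_point_def tangent_bundle_def tangent_vector_in point_in_dom)

lemma openin_tangent_iff:
  "openin (tangent_topology A) W \<longleftrightarrow> W \<subseteq> tangent_bundle A \<and>
     (\<forall>c\<in>A. open {w. fst w \<in> img_of c \<and> tangent_point c w \<in> W})"
  by (simp add: openin_tangent_topology[OF smooth_atlas] tangent_open_def tangent_point_def
      case_prod_unfold)

lemma topspace_tangent: "topspace (tangent_topology A) = tangent_bundle A"
proof -
  have "{w. fst w \<in> img_of c \<and> tangent_point c w \<in> tangent_bundle A} = img_of c \<times> UNIV"
    if "c \<in> A" for c
    using tangent_point_in[OF that] by auto
  then have "openin (tangent_topology A) (tangent_bundle A)"
    by (simp add: openin_tangent_iff open_Times open_img)
  then show ?thesis
    using openin_subset[OF \<open>openin _ (tangent_bundle A)\<close>]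
      openin_topspace[of "tangent_topology A"] unfolding openin_tangent_iff by blast
qed

lemma topspace_phase: "topspace (phase_space A) = tangent_bundle A \<times> UNIV"
  by (simp add: phase_space_def topspace_tangent)

lemma phase_point_in: "c \<in> A \<Longrightarrow> w \<in> phase_dom c \<Longrightarrow> phase_point c w \<in> topspace (phase_space A)"
  by (auto simp: topspace_phase phase_point_def phase_dom_def intro!: tangent_point_in)

lemma phase_point_cover:
  assumes "z \<in> topspace (phase_space A)"
  obtains c w where "c \<in> A" "w \<in> phase_dom c" "z = phase_point c w"
proof -
  obtain q v \<tau> where z: "z = ((q, v), \<tau>)" "v \<in> tangent_space A q"
    using assms by (auto simp: topspace_phase tangent_bundle_def)
  obtain c where c: "c \<in> A" "q \<in> dom_of c" by (rule chart_around)
  have "z = phase_point c ((coord c q, v c), rep_circle \<tau>)"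
    using z c by (simp add: phase_point_def tangent_point_def point_coord tangent_vector_of_coord
        abs_rep_circle)
  with c show thesis
    by (intro that[of c "((coord c q, v c), rep_circle \<tau>)"]) (auto simp: phase_dom_def coord_in_img)
qed

text \<open>Seen in another chart \<open>d\<close>, the image is the preimage of \<open>U\<close>
  under the tangent map of the transition from \<open>d\<close> to \<open>c\<close>, which sends a
  base point to its new coordinates and a vector to its image under the Jacobian. That map is
  continuous on the open overlap.\<close>

lemma openin_tangent_point_image:
  assumes c: "c \<in> A" and "open U" and U: "U \<subseteq> img_of c \<times> UNIV"
  shows "openin (tangent_topology A) (tangent_point c ` U)"
  unfolding openin_tangent_iff
proof (intro conjI ballI)
  show "tangent_point c ` U \<subseteq> tangent_bundle A"
    using tangent_point_in[OF c] U by force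
  fix d assume d: "d \<in> A"
  let ?S = "coord d ` (dom_of d \<inter> dom_of c)"
  let ?\<Phi> = "\<lambda>w. (transition d c (fst w), frechet_derivative (transition d c) (at (fst w)) (snd w))"
  have "fst w \<in> img_of d \<and> tangent_point d w \<in> tangent_point c ` U \<longleftrightarrow>
      w \<in> (?S \<times> UNIV) \<inter> ?\<Phi> -` U" for w
  proof
    assume w: "fst w \<in> img_of d \<and> tangent_point d w \<in> tangent_point c ` U"
    define q where "q = point d (fst w)"
    have q: "q \<in> dom_of d" "fst w = coord d q"
      using w d by (simp_all add: q_def point_in_dom coord_point)
    obtain u where u: "u \<in> U" "tangent_point d w = tangent_point c u" using w by auto
    have u1: "fst u \<in> img_of c" using u U by auto
    have q': "q = point c (fst u)" and
      v: "tangent_vector A d q (snd w) = tangent_vector A c q (snd u)"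
      using u(2) by (auto simp: tangent_point_def q_def)
    have qc: "q \<in> dom_of c" "coord c q = fst u"
      using q' u1 c by (simp_all add: point_in_dom coord_point)
    have "snd u = jacobian d c q (snd w)"
      using tangent_vector_coord[OF c qc(1), of "snd u"] c qc(1) unfolding v[symmetric]
      by (simp add: tangent_vector_def)
    then have "?\<Phi> w = u"
      using q qc d by (simp add: transition_coord prod_eq_iff)
    then show "w \<in> (?S \<times> UNIV) \<inter> ?\<Phi> -` U"
      using u(1) q qc(1) by (auto simp: mem_Times_iff)
  next
    assume w: "w \<in> (?S \<times> UNIV) \<inter> ?\<Phi> -` U"
    then obtain q where q: "q \<in> dom_of d" "q \<in> dom_of c" "fst w = coord d q"
      by (auto simp: mem_Times_iff)
    have "tangent_vector A d q (snd w) = tangent_vector A c q (jacobian d c q (snd w))"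
      using tangent_vector_of_coord[OF c q(2) tangent_vector_in[OF d q(1), of "snd w"]] c q(2)
      by (simp add: tangent_vector_def)
    then have "tangent_point d w = tangent_point c (?\<Phi> w)"
      using q c d by (simp add: tangent_point_def point_coord transition_coord)
    moreover have "?\<Phi> w \<in> U" using w by simp
    ultimately show "fst w \<in> img_of d \<and> tangent_point d w \<in> tangent_point c ` U"
      using q(1,3) by (simp add: coord_in_img)
  qed
  then have "{w. fst w \<in> img_of d \<and> tangent_point d w \<in> tangent_point c ` U} =
      (?S \<times> UNIV) \<inter> ?\<Phi> -` U"
    by blast
  moreover have "continuous_on (?S \<times> UNIV) ?\<Phi>"
  proof (intro continuous_on_Pair)
    show "continuous_on (?S \<times> UNIV) (\<lambda>w. transition d c (fst w))"
      by (rule continuous_on_compose2[OF smooth_on_imp_continuous_on[OF smooth_transition[OF d c]]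
            continuous_on_fst[OF continuous_on_id]]) auto
    show "continuous_on (?S \<times> UNIV) (\<lambda>w. frechet_derivative (transition d c) (at (fst w)) (snd w))"
      using continuous_on_frechet_derivative[OF smooth_transition[OF d c]]
      by (simp add: case_prod_unfold)
  qed
  then have "open ((?S \<times> UNIV) \<inter> ?\<Phi> -` U)"
    using \<open>open U\<close> by (intro continuous_open_preimage open_Times open_overlap c d) auto
  ultimately show "open {w. fst w \<in> img_of d \<and> tangent_point d w \<in> tangent_point c ` U}"
    by simp
qed

lemma openin_phase_point_image:
  assumes c: "c \<in> A" and "open W" and W: "W \<subseteq> phase_dom c"
  shows "openin (phase_space A) (phase_point c ` W)"
  unfolding phase_space_def openin_prod_topology_alt
proof (intro allI impI)
  fix z \<tau> assume "(z, \<tau>) \<in> phase_point c ` W"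
  then obtain u t where w: "(u, t) \<in> W" "z = tangent_point c u" "\<tau> = abs_circle t"
    by (auto simp: phase_point_def)
  obtain U V where UV: "open U" "open V" "u \<in> U" "t \<in> V" "U \<times> V \<subseteq> W"
    using open_prod_elim[OF \<open>open W\<close> w(1)] by (metis mem_Sigma_iff)
  have "U \<subseteq> img_of c \<times> UNIV"
    using UV(4,5) W unfolding phase_dom_def by blast
  then have "openin (tangent_topology A) (tangent_point c ` U)"
    by (rule openin_tangent_point_image[OF c UV(1)])
  moreover have "openin euclidean (abs_circle ` V)"
    using open_abs_circle_image[OF UV(2)] by simp
  moreover have "tangent_point c ` U \<times> abs_circle ` V \<subseteq> phase_point c ` W"
    using UV(5) by (force simp: phase_point_def image_iff)
  ultimately show "\<exists>U V. openin (tangent_topology A) U \<and> openin euclidean V \<and> z \<in> U \<and> \<tau> \<in> V \<and>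
      U \<times> V \<subseteq> phase_point c ` W"
    using w(2,3) UV(3,4) by blast
qed

section \<open>Borel measurability and integrability tested in charts\<close>

definition phase_borel :: "(('m \<times> ('m, 'n) tvec) \<times> circle) measure \<Rightarrow> bool" where
  "phase_borel \<mu> \<longleftrightarrow>
     sets \<mu> = sets (sigma (topspace (phase_space A)) {U. openin (phase_space A) U})"

lemma phase_borel_space:
  assumes "phase_borel \<mu>"
  shows "space \<mu> = topspace (phase_space A)"
proof -
  have "{U. openin (phase_space A) U} \<subseteq> Pow (topspace (phase_space A))"
    by (auto dest: openin_subset)
  then show ?thesis
    using sets_eq_imp_space_eq[OF assms[unfolded phase_borel_def]] by simp
qed

lemma phase_borel_open:
  assumes "phase_borel \<mu>" "openin (phase_space A) U"
  shows "U \<in> sets \<mu>"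
proof -
  have "{U. openin (phase_space A) U} \<subseteq> Pow (topspace (phase_space A))"
    by (auto dest: openin_subset)
  then show ?thesis
    using assms(2) unfolding assms(1)[unfolded phase_borel_def] by simp
qed

text \<open>A superlevel set is the union of the images of the superlevel sets in the charts. All of
  these are open, so their union is open and hence measurable however large the atlas is.\<close>

lemma borel_measurable_phase:
  fixes f :: "('m \<times> ('m, 'n) tvec) \<times> circle \<Rightarrow> real"
  assumes "phase_borel \<mu>"
    and lsc: "\<And>c a. c \<in> A \<Longrightarrow> open {w \<in> phase_dom c. a < f (phase_point c w)}"
  shows "f \<in> borel_measurable \<mu>"
proof (rule borel_measurableI_greater)
  fix a
  have "{z \<in> space \<mu>. a < f z} =
      (\<Union>c\<in>A. phase_point c ` {w \<in> phase_dom c. a < f (phase_point c w)})"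
    (is "?L = ?R")
  proof (intro equalityI subsetI)
    fix z assume z: "z \<in> ?L"
    then have "z \<in> topspace (phase_space A)" by (simp add: phase_borel_space[OF assms(1)])
    then obtain c w where "c \<in> A" "w \<in> phase_dom c" "z = phase_point c w"
      by (rule phase_point_cover)
    with z show "z \<in> ?R" by blast
  next
    fix z assume "z \<in> ?R"
    then show "z \<in> ?L"
      by (auto simp: phase_borel_space[OF assms(1)] phase_point_in)
  qed
  moreover have "openin (phase_space A)
      (\<Union>c\<in>A. phase_point c ` {w \<in> phase_dom c. a < f (phase_point c w)})"
    using lsc by (intro openin_Union ballI) (auto intro!: openin_phase_point_image)
  ultimately show "{z \<in> space \<mu>. a < f z} \<in> sets \<mu>"
    using phase_borel_open[OF assms(1)] by simp
qed

text \<open>Open sets on which \<open>f\<close> is bounded cover \<open>K\<close>, and a finite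
  subcover gives a common bound. Local boundedness replaces continuity so that lower semicontinuous
  functions are covered too.\<close>

lemma bounded_on_compactin_phase:
  fixes f :: "('m \<times> ('m, 'n) tvec) \<times> circle \<Rightarrow> real"
  assumes "compactin (phase_space A) K"
    and bounded: "\<And>c w. c \<in> A \<Longrightarrow> w \<in> phase_dom c \<Longrightarrow>
      \<exists>W B. open W \<and> w \<in> W \<and> W \<subseteq> phase_dom c \<and> (\<forall>w'\<in>W. \<bar>f (phase_point c w')\<bar> \<le> B)"
  shows "\<exists>B. \<forall>z\<in>K. \<bar>f z\<bar> \<le> B"
proof -
  define \<U> where "\<U> = {U. openin (phase_space A) U \<and> (\<exists>B. \<forall>z\<in>U. \<bar>f z\<bar> \<le> B)}"
  have "K \<subseteq> \<Union>\<U>"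
  proof
    fix z assume "z \<in> K"
    then have "z \<in> topspace (phase_space A)"
      using compactin_subset_topspace[OF assms(1)] by blast
    then obtain c w where c: "c \<in> A" and w: "w \<in> phase_dom c" "z = phase_point c w"
      by (rule phase_point_cover)
    obtain W B where W: "open W" "w \<in> W" "W \<subseteq> phase_dom c" "\<forall>w'\<in>W. \<bar>f (phase_point c w')\<bar> \<le> B"
      using bounded[OF c w(1)] by metis
    have "phase_point c ` W \<in> \<U>"
      using openin_phase_point_image[OF c W(1,3)] W(4) by (auto simp: \<U>_def)
    then show "z \<in> \<Union>\<U>" using w(2) W(2) by blast
  qed
  moreover have "\<forall>U\<in>\<U>. openin (phase_space A) U" by (simp add: \<U>_def)
  ultimately obtain \<F> where \<F>: "finite \<F>" "\<F> \<subseteq> \<U>" "K \<subseteq> \<Union>\<F>"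
    using assms(1) unfolding compactin_def by metis
  have "\<forall>U\<in>\<F>. \<exists>B. \<forall>z\<in>U. \<bar>f z\<bar> \<le> B" using \<F>(2) by (auto simp: \<U>_def)
  then obtain B where B: "\<And>U z. U \<in> \<F> \<Longrightarrow> z \<in> U \<Longrightarrow> \<bar>f z\<bar> \<le> B U" by metis
  have "\<bar>f z\<bar> \<le> Max (B ` \<F>)" if "z \<in> K" for z
  proof -
    obtain U where U: "U \<in> \<F>" "z \<in> U" using \<F>(3) \<open>z \<in> K\<close> by blast
    then have "\<bar>f z\<bar> \<le> B U" by (rule B)
    also have "\<dots> \<le> Max (B ` \<F>)" using \<F>(1) U(1) by simp
    finally show ?thesis .
  qed
  then show ?thesis by blast
qed

lemma integrable_phase:
  fixes f :: "('m \<times> ('m, 'n) tvec) \<times> circle \<Rightarrow> real"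
  assumes \<mu>: "\<mu> \<in> invariant_measures A L"
    and lsc: "\<And>c a. c \<in> A \<Longrightarrow> open {w \<in> phase_dom c. a < f (phase_point c w)}"
    and bounded: "\<And>c w. c \<in> A \<Longrightarrow> w \<in> phase_dom c \<Longrightarrow>
      \<exists>W B. open W \<and> w \<in> W \<and> W \<subseteq> phase_dom c \<and> (\<forall>w'\<in>W. \<bar>f (phase_point c w')\<bar> \<le> B)"
  shows "integrable \<mu> f"
proof -
  interpret prob_space \<mu> using \<mu> by (simp add: invariant_measures_def)
  have borel: "phase_borel \<mu>" using \<mu> by (simp add: invariant_measures_def phase_borel_def)
  obtain K where K: "compactin (phase_space A) K" "AE z in \<mu>. z \<in> K"
    using \<mu> by (auto simp: invariant_measures_def)
  obtain B where B: "\<And>z. z \<in> K \<Longrightarrow> \<bar>f z\<bar> \<le> B"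
    using bounded_on_compactin_phase[OF K(1) bounded] by blast
  have "AE z in \<mu>. norm (f z) \<le> B"
    using K(2) by eventually_elim (simp add: B)
  then show ?thesis
    using borel_measurable_phase[OF borel lsc] by (rule integrable_const_bound)
qed

section \<open>Distribution of the time coordinate, and integrability of closed forms\<close>

lemma borel_measurable_circle:
  fixes F :: "circle \<Rightarrow> real"
  assumes "phase_borel \<mu>" "\<And>a. open {t. a < F (abs_circle t)}"
  shows "(\<lambda>z. F (snd z)) \<in> borel_measurable \<mu>"
proof (rule borel_measurable_phase[OF assms(1)])
  fix c a assume c: "c \<in> A"
  have "{w \<in> phase_dom c. a < F (snd (phase_point c w))} =
      (img_of c \<times> UNIV) \<times> {t. a < F (abs_circle t)}"
    by (auto simp: phase_dom_def phase_point_def)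
  then show "open {w \<in> phase_dom c. a < F (snd (phase_point c w))}"
    using assms(2) open_img[OF c] by (simp add: open_Times)
qed

text \<open>The flow covers the rotation of the time circle, whatever the Euler-Lagrange curves are;
  hence the circle marginal of an invariant measure is Lebesgue measure.\<close>

lemma integral_circle_marginal:
  fixes F :: "circle \<Rightarrow> real"
  assumes \<mu>: "\<mu> \<in> invariant_measures A L"
    and lsc: "\<And>a. open {t. a < F (abs_circle t)}" and B: "\<And>\<tau>. \<bar>F \<tau>\<bar> \<le> B"
  shows "integrable \<mu> (\<lambda>z. F (snd z))"
    "(\<integral>z. F (snd z) \<partial>\<mu>) = integral {0..1} (\<lambda>t. F (abs_circle t))"
proof -
  interpret prob_space \<mu> using \<mu> by (simp add: invariant_measures_def)
  have borel: "phase_borel \<mu>" using \<mu> by (simp add: invariant_measures_def phase_borel_def)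
  have flow: "flow A L s \<in> \<mu> \<rightarrow>\<^sub>M \<mu>" "distr \<mu> \<mu> (flow A L s) = \<mu>" for s
    using \<mu> by (auto simp: invariant_measures_def)
  have snd_flow: "snd (flow A L s z) = abs_circle (rep_circle (snd z) + s)" for s z
    by (simp add: flow_def Let_def case_prod_unfold)
  have meas: "(\<lambda>z. F (snd z)) \<in> borel_measurable \<mu>"
    by (rule borel_measurable_circle[OF borel lsc])
  then show "integrable \<mu> (\<lambda>z. F (snd z))"
    using B by (intro integrable_const_bound[where B = B]) auto
  \<comment> \<open>\<open>rep_circle\<close> picks an arbitrary real representative. Its fractional
    part depends only on the point of the circle, is bounded and is measurable.\<close>
  let ?X = "\<lambda>z::('m \<times> ('m, 'n) tvec) \<times> circle. frac (rep_circle (snd z))"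
  have X: "?X \<in> borel_measurable \<mu>"
    by (rule borel_measurable_circle[OF borel])
      (simp add: frac_eq_if_diff_Ints[OF rep_abs_circle] open_frac_greater)
  have FX: "F (abs_circle (?X z + s)) = F (snd (flow A L s z))" for z s
    by (simp add: abs_circle_frac_add snd_flow)
  \<comment> \<open>Shifting the time coordinate by \<open>s\<close> is composition with the
    time-\<open>s\<close> flow as far as \<open>F\<close> is concerned, so this is invariance of
    \<mu> under that flow.\<close>
  have inv: "expectation (\<lambda>z. F (abs_circle (?X z + s))) = expectation (\<lambda>z. F (snd z))" for s
    unfolding FX using integral_distr[OF flow(1) meas, of s] flow(2)[of s] by simp
  have F_borel: "(\<lambda>t. F (abs_circle t)) \<in> borel_measurable borel"
    by (rule borel_measurableI_greater) (simp add: lsc)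
  have FX0: "F (abs_circle (?X z)) = F (snd z)" for z
    using abs_circle_frac_add[of "rep_circle (snd z)" 0] by (simp add: abs_rep_circle)
  have "expectation (\<lambda>z. F (abs_circle (?X z))) = integral {0..1} (\<lambda>t. F (abs_circle t))"
  proof (rule expectation_shift_invariant_periodic[OF X _ F_borel B])
    show "0 \<le> ?X z \<and> ?X z \<le> 1" for z
      using frac_lt_1[of "rep_circle (snd z)"] by simp
    show "expectation (\<lambda>z. F (abs_circle (?X z + s))) = expectation (\<lambda>z. F (abs_circle (?X z)))" for s
      unfolding inv FX0 ..
  qed (simp add: abs_circle_add_1)
  then show "(\<integral>z. F (snd z) \<partial>\<mu>) = integral {0..1} (\<lambda>t. F (abs_circle t))"
    unfolding FX0 .
qed

lemma integrable_phase_continuous: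
  fixes f :: "('m \<times> ('m, 'n) tvec) \<times> circle \<Rightarrow> real"
  assumes "\<mu> \<in> invariant_measures A L"
    and cont: "\<And>c. c \<in> A \<Longrightarrow> continuous_on (phase_dom c) (\<lambda>w. f (phase_point c w))"
  shows "integrable \<mu> f"
proof (rule integrable_phase[OF assms(1)])
  have preimage: "open (phase_dom c \<inter> (\<lambda>w. f (phase_point c w)) -` S)" if "c \<in> A" "open S" for c S
    using cont that by (intro continuous_open_preimage open_phase_dom)
  show "open {w \<in> phase_dom c. a < f (phase_point c w)}" if "c \<in> A" for c a
    using preimage[OF that, of "{a<..}"] by (simp add: vimage_def Int_def)
  show "\<exists>W B. open W \<and> w \<in> W \<and> W \<subseteq> phase_dom c \<and> (\<forall>w'\<in>W. \<bar>f (phase_point c w')\<bar> \<le> B)"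
    if "c \<in> A" "w \<in> phase_dom c" for c w
    using preimage[OF that(1), of "{-(\<bar>f (phase_point c w)\<bar> + 1)<..<\<bar>f (phase_point c w)\<bar> + 1}"] that(2)
    by (intro exI[of _ "phase_dom c \<inter> (\<lambda>w. f (phase_point c w)) -`
          {-(\<bar>f (phase_point c w)\<bar> + 1)<..<\<bar>f (phase_point c w)\<bar> + 1}"]
        exI[of _ "\<bar>f (phase_point c w)\<bar> + 1"]) auto
qed

text \<open>In a chart the form is the inner product of its coefficients with the velocity, hence
  continuous. It is unbounded on the fibres; compactness of the support supplies the bound.\<close>

lemma integrable_form:
  assumes "\<mu> \<in> invariant_measures A L" "\<theta> \<in> closed_forms A"
  shows "integrable \<mu> (\<lambda>z. \<theta> (fst (fst z)) (snd (fst z)))"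
proof (rule integrable_phase_continuous[OF assms(1)])
  fix c assume c: "c \<in> A"
  have "\<theta> (fst (fst (phase_point c w))) (snd (fst (phase_point c w))) =
      form_coords A \<theta> c (fst (fst w)) \<bullet> snd (fst w)" if "w \<in> phase_dom c" for w
  proof -
    define q where "q = point c (fst (fst w))"
    have q: "q \<in> dom_of c" "coord c q = fst (fst w)"
      using that c by (auto simp: q_def phase_dom_def point_in_dom coord_point)
    show ?thesis
      using form_coords_eq[of c q \<theta>, OF c q(1) closed_form_cotangent[OF assms(2)]]
        cotangent_vector_apply[OF c q(1)] q(2)
      by (simp add: phase_point_def tangent_point_def flip: q_def)
  qed
  moreover have "continuous_on (phase_dom c) (\<lambda>w. form_coords A \<theta> c (fst (fst w)) \<bullet> snd (fst w))"
    by (intro continuous_intros continuous_on_compose2[OF smooth_on_imp_continuous_on[OF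
          smooth_form_coords[OF assms(2) c]], where f = "\<lambda>w. fst (fst w)"])
      (auto simp: phase_dom_def)
  ultimately show "continuous_on (phase_dom c)
      (\<lambda>w. \<theta> (fst (fst (phase_point c w))) (snd (fst (phase_point c w))))"
    by (simp cong: continuous_on_cong)
qed

end

section \<open>Hamiltonians and their Legendre transforms\<close>

locale tonelli_hamiltonian = atlas A
  for A :: "('m::topological_space, 'n::finite) chart set" +
  fixes g :: "'m \<Rightarrow> ('m, 'n) tvec \<Rightarrow> ('m, 'n) tvec \<Rightarrow> real"
    and H :: "('m, 'n) hamiltonian"
  assumes riemannian: "riemannian_metric A g"
    and smooth: "smooth_hamiltonian A H"
    and hessian: "positive_fibre_hessian A H"
    and superlinear: "superlinear A g H"
begin

section \<open>Regularity, convexity and growth of the Hamiltonian in coordinates\<close>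

definition ham :: "('m, 'n) chart \<Rightarrow> real ^ 'n \<Rightarrow> real ^ 'n \<Rightarrow> real \<Rightarrow> real" where
  "ham c x y t = H (point c x) (cotangent_vector A c (point c x) y) (abs_circle t)"

lemma smooth_ham: "c \<in> A \<Longrightarrow> smooth_on (img_of c \<times> UNIV \<times> UNIV) (\<lambda>(x, y, t). ham c x y t)"
  using smooth by (simp add: smooth_hamiltonian_def ham_def)

lemma continuous_on_ham:
  assumes "c \<in> A" "continuous_on S u" "continuous_on S v" "continuous_on S s" "u ` S \<subseteq> img_of c"
  shows "continuous_on S (\<lambda>z. ham c (u z) (v z) (s z))"
  using continuous_on_compose2[OF smooth_on_imp_continuous_on[OF smooth_ham[OF assms(1)]],
      of S "\<lambda>z. (u z, v z, s z)"] assms by (auto simp: continuous_on_Pair)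

text \<open>On each line in the fibre the second derivative is nonnegative. Smoothness in
  coordinates gives the two derivatives as iterated directional derivatives \<open>G1\<close> and
  \<open>G2\<close> along \<open>e\<close>; a zero direction is treated apart, because the Hessian
  condition concerns nonzero covectors.\<close>

lemma convex_ham:
  assumes c: "c \<in> A" and x: "x \<in> img_of c"
  shows "convex_on UNIV (\<lambda>y. ham c x y t)"
proof (rule convex_on_UNIV_lines)
  fix y v :: "real ^ 'n"
  show "convex_on UNIV (\<lambda>s. ham c x (y + s *\<^sub>R v) t)"
  proof (cases "v = 0")
    case True
    then show ?thesis by (simp add: convex_on_const)
  next
    case False
    let ?S = "img_of c \<times> (UNIV :: (real ^ 'n) set) \<times> (UNIV :: real set)"
    define G where "G = (\<lambda>(x, y, t). ham c x y t)"
    define e where "e = (0 :: real ^ 'n, v, 0 :: real)"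
    define G1 where "G1 = (\<lambda>z. frechet_derivative G (at z) e)"
    define G2 where "G2 = (\<lambda>z. frechet_derivative G1 (at z) e)"
    define P where "P = (\<lambda>y s. (x, y + s *\<^sub>R v, t))"
    have G: "smooth_on ?S G" using smooth_ham[OF c] by (simp add: G_def)
    have G1: "smooth_on ?S G1" unfolding G1_def by (rule smooth_on_frechet_derivative[OF G])
    have P_in: "P y s \<in> ?S" for y s using x by (simp add: P_def)
    have deriv_line: "((\<lambda>s. F (P y s)) has_real_derivative frechet_derivative F (at (P y s)) e) (at s)"
      if "smooth_on ?S F" for F :: "(real ^ 'n) \<times> (real ^ 'n) \<times> real \<Rightarrow> real" and y s
    proof -
      have "(P y has_derivative (\<lambda>r. r *\<^sub>R e)) (at s)"
        unfolding P_def e_def by (auto intro!: derivative_eq_intros)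
      moreover have F: "(F has_derivative frechet_derivative F (at (P y s))) (at (P y s))"
        using smooth_on_imp_differentiable[OF that P_in] by (simp flip: frechet_derivative_works)
      ultimately have "((\<lambda>s. F (P y s)) has_derivative
          (\<lambda>r. frechet_derivative F (at (P y s)) (r *\<^sub>R e))) (at s)"
        by (rule has_derivative_compose)
      then show ?thesis
        by (simp add: has_field_derivative_def linear_scale[OF has_derivative_linear[OF F]]
            mult.commute[of _ "frechet_derivative F (at (P y s)) e"])
    qed
    have "G2 (P y s) \<ge> 0" for s
    proof -
      define q where "q = point c x"
      \<comment> \<open>The Hessian condition evaluates the second derivative at parameter
        \<open>0\<close> only, so the base covector is moved along the line to the point of
        interest.\<close>
      define z where "z = y + s *\<^sub>R v"
      have q: "q \<in> dom_of c" using point_in_dom[OF c x] by (simp add: q_def)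
      have "0 < (deriv ^^ 2) (\<lambda>r. H q (\<lambda>X. cotangent_vector A c q z X + r * cotangent_vector A c q v X)
          (abs_circle t)) 0"
        using hessian cotangent_vector_in[of c q] cotangent_vector_nonzero[OF c q False]
        unfolding positive_fibre_hessian_def by blast
      also have "(\<lambda>r. H q (\<lambda>X. cotangent_vector A c q z X + r * cotangent_vector A c q v X)
          (abs_circle t)) = (\<lambda>r. G (P z r))"
        by (simp add: cotangent_vector_line G_def P_def ham_def q_def)
      also have "deriv (\<lambda>r. G (P z r)) = (\<lambda>r. G1 (P z r))"
        using deriv_line[OF G] unfolding G1_def by (intro ext DERIV_imp_deriv)
      then have "(deriv ^^ 2) (\<lambda>r. G (P z r)) 0 = deriv (\<lambda>r. G1 (P z r)) 0"
        by (simp add: numeral_2_eq_2)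
      also have "\<dots> = G2 (P z 0)"
        unfolding G2_def by (rule DERIV_imp_deriv[OF deriv_line[OF G1]])
      also have "P z 0 = P y s" by (simp add: P_def z_def)
      finally show ?thesis by simp
    qed
    then have "convex_on UNIV (\<lambda>s. G (P y s))"
      using deriv_line[OF G] deriv_line[OF G1] unfolding G1_def[symmetric] G2_def[symmetric]
      by (intro f''_ge0_imp_convex[where f' = "\<lambda>s. G1 (P y s)" and f'' = "\<lambda>s. G2 (P y s)"])
        (simp_all add: G1_def G2_def)
    then show ?thesis by (simp add: G_def P_def)
  qed
qed

text \<open>Testing the covector with coordinates \<open>y\<close> on a multiple of the vector with
  the same coordinates bounds its dual norm from below. The two sides of the comparison of
  \<open>b\<close> with the Euclidean norm serve different ends: the upper constant \<open>M\<close>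
  makes the test vector admissible, the lower constant \<open>m\<close> makes the supremum
  finite.\<close>

lemma covector_norm_ge:
  assumes c: "c \<in> A" and q: "q \<in> dom_of c"
  obtains k where "k > 0" "\<And>y. norm y \<le> k * covector_norm A g q (cotangent_vector A c q y)"
proof -
  let ?v = "tangent_vector A c q"
  define b where "b y z = g q (?v y) (?v z)" for y z
  have sym: "b y z = b z y" for y z
    using riemannian tangent_vector_in[OF c q] by (simp add: riemannian_metric_def b_def)
  have "linear (b y)" for y
    unfolding b_def
    using riemannian tangent_vector_in[OF c q]
    by (intro linear_on_tangent_coords[OF c q]) (simp add: riemannian_metric_def)
  then have "bilinear b" using sym by (simp add: bilinear_def)
  then interpret b: bounded_bilinear b by (simp add: bilinear_conv_bounded_bilinear)
  have pos: "b y y > 0" if "y \<noteq> 0" for y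
  proof -
    have "?v y \<noteq> (\<lambda>_. 0)"
      using tangent_vector_coord[OF c q, of y] that by auto
    then show ?thesis
      using riemannian tangent_vector_in[OF c q] by (simp add: riemannian_metric_def b_def)
  qed
  have scale: "b (r *\<^sub>R y) (r *\<^sub>R y) = r\<^sup>2 * b y y" for r y
    by (simp add: b.scaleR_left b.scaleR_right power2_eq_square)
  \<comment> \<open>The minimum of \<open>b\<close> on the Euclidean unit sphere is attained and
    positive, so the unit ball of the metric is bounded in coordinates.\<close>
  obtain u where u: "norm u = 1" "\<And>y. norm y = 1 \<Longrightarrow> b u u \<le> b y y"
  proof -
    have "\<exists>u\<in>sphere 0 1. \<forall>y\<in>sphere 0 1. b u u \<le> b y y"
      by (rule continuous_attains_inf) (auto intro!: b.continuous_on continuous_intros)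
    then show thesis using that by auto
  qed
  define m where "m = b u u"
  have "u \<noteq> 0" using u(1) by auto
  then have m: "m > 0" unfolding m_def by (rule pos)
  have lower: "m * (norm y)\<^sup>2 \<le> b y y" for y
  proof (cases "y = 0")
    case False
    have "m \<le> b ((1 / norm y) *\<^sub>R y) ((1 / norm y) *\<^sub>R y)"
      unfolding m_def using False by (intro u(2)) simp
    then show ?thesis using False unfolding scale by (simp add: field_simps)
  qed (simp add: b.zero_left)
  obtain M where M: "M > 0" "\<And>y z. norm (b y z) \<le> norm y * norm z * M"
    using b.pos_bounded by blast
  have "norm y \<le> sqrt M * covector_norm A g q (cotangent_vector A c q y)" for y
  proof (cases "y = 0")
    case True
    have zero_in: "?v 0 \<in> {X \<in> tangent_space A q. g q X X \<le> 1}"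
      using tangent_vector_in[OF c q] b.zero_left[of 0] by (simp add: b_def)
    have "cotangent_vector A c q y = (\<lambda>_. 0)" using True by (auto simp: cotangent_vector_def)
    moreover have "{X \<in> tangent_space A q. g q X X \<le> 1} \<noteq> {}" using zero_in by blast
    then have "covector_norm A g q (\<lambda>_. 0) = 0"
      unfolding covector_norm_def by (rule cSUP_const)
    ultimately show ?thesis using True by simp
  next
    case False
    \<comment> \<open>The largest scaling for which the bound by \<open>M\<close> guarantees metric
      length at most \<open>1\<close>.\<close>
    define r where "r = 1 / (sqrt M * norm y)"
    have "b (r *\<^sub>R y) (r *\<^sub>R y) \<le> r\<^sup>2 * (norm y * norm y * M)"
      unfolding scale using M(2)[of y y] by (intro mult_left_mono) auto
    also have "\<dots> = 1"
      using M(1) False by (simp add: r_def field_simps power2_eq_square)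
    finally have unit: "?v (r *\<^sub>R y) \<in> {X \<in> tangent_space A q. g q X X \<le> 1}"
      using tangent_vector_in[OF c q] by (simp add: b_def)
    have bdd: "bdd_above (cotangent_vector A c q y ` {X \<in> tangent_space A q. g q X X \<le> 1})"
    proof (rule bdd_aboveI2)
      fix X assume X: "X \<in> {X \<in> tangent_space A q. g q X X \<le> 1}"
      have "b (X c) (X c) \<le> 1" using X tangent_vector_of_coord[OF c q] by (simp add: b_def)
      then have "(norm (X c))\<^sup>2 \<le> 1 / m"
        using lower[of "X c"] m by (simp add: field_simps)
      then have "norm (X c) \<le> sqrt (1 / m)" by (rule real_le_rsqrt)
      then have "norm y * norm (X c) \<le> norm y * sqrt (1 / m)" by (intro mult_left_mono) auto
      then show "cotangent_vector A c q y X \<le> norm y * sqrt (1 / m)"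
        using X norm_cauchy_schwarz[of y "X c"] by (simp add: cotangent_vector_def)
    qed
    have "norm y = sqrt M * cotangent_vector A c q y (?v (r *\<^sub>R y))"
      using M(1) False by (simp add: cotangent_vector_apply[OF c q] r_def dot_square_norm
          power2_eq_square)
    also have "\<dots> \<le> sqrt M * covector_norm A g q (cotangent_vector A c q y)"
      unfolding covector_norm_def using M(1) by (intro mult_left_mono cSUP_upper[OF unit bdd]) auto
    finally show ?thesis .
  qed
  then show thesis using M(1) by (intro that[of "sqrt M"]) auto
qed

lemma superlinear_ham:
  assumes c: "c \<in> A" and x: "x \<in> img_of c"
  shows "\<exists>R. \<forall>y. norm y \<ge> R \<longrightarrow> ham c x y t \<ge> K * norm y"
proof -
  define q where "q = point c x"
  have q: "q \<in> dom_of c" using point_in_dom[OF c x] by (simp add: q_def)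
  obtain k where k: "k > 0" "\<And>y. norm y \<le> k * covector_norm A g q (cotangent_vector A c q y)"
    using covector_norm_ge[OF c q] by metis
  \<comment> \<open>The slope \<open>K\<close> may be negative, whereas the comparison of norms can
    be multiplied only by a nonnegative factor. The factor \<open>k\<close> converts the dual norm
    into the Euclidean norm.\<close>
  obtain R where R: "\<And>p. p \<in> cotangent_space A q \<Longrightarrow> covector_norm A g q p \<ge> R \<Longrightarrow>
      H q p (abs_circle t) \<ge> (\<bar>K\<bar> * k) * covector_norm A g q p"
    using superlinear unfolding superlinear_def by metis
  have "ham c x y t \<ge> K * norm y" if "norm y \<ge> k * R" for y
  proof -
    let ?N = "covector_norm A g q (cotangent_vector A c q y)"
    have "k * R \<le> k * ?N" using that k(2)[of y] by linarith
    then have "R \<le> ?N" using k(1) by simp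
    then have "ham c x y t \<ge> \<bar>K\<bar> * k * ?N"
      using R[OF cotangent_vector_in] by (simp add: ham_def q_def)
    moreover have "\<bar>K\<bar> * norm y \<le> \<bar>K\<bar> * (k * ?N)" using k(2) by (intro mult_left_mono) auto
    moreover have "K * norm y \<le> \<bar>K\<bar> * norm y" by (intro mult_right_mono) auto
    ultimately show ?thesis by (simp add: mult.assoc)
  qed
  then show ?thesis by blast
qed

section \<open>The Legendre transform as a supremum of continuous functions in coordinates\<close>

definition fenchel :: "('m, 'n) chart \<Rightarrow> real ^ 'n \<Rightarrow> ((real ^ 'n) \<times> (real ^ 'n)) \<times> real \<Rightarrow> real" where
  "fenchel c \<eta> w = \<eta> \<bullet> snd (fst w) - ham c (fst (fst w)) \<eta> (snd w)"

text \<open>The value sets themselves are compared, so that both the supremum and its boundedness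
  pass between the fibre and the chart.\<close>

lemma fenchel_image:
  assumes c: "c \<in> A" and w: "w \<in> phase_dom c" and z: "phase_point c w = ((q, v), \<tau>)"
  shows "(\<lambda>p. p v - H q p \<tau>) ` cotangent_space A q = range (\<lambda>\<eta>. fenchel c \<eta> w)"
proof -
  have q: "q = point c (fst (fst w))" "q \<in> dom_of c"
    and v: "v = tangent_vector A c q (snd (fst w))" and \<tau>: "\<tau> = abs_circle (snd w)"
    using z w c by (auto simp: phase_point_def tangent_point_def phase_dom_def point_in_dom)
  show ?thesis
    unfolding cotangent_space_eq[OF c q(2)] image_image
    by (simp add: v \<tau> cotangent_vector_apply[OF c q(2)] fenchel_def ham_def flip: q(1))
qed

lemma fenchel_locally_bounded:
  assumes c: "c \<in> A" and w: "w \<in> phase_dom c"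
  shows "\<exists>W B. open W \<and> w \<in> W \<and> W \<subseteq> phase_dom c \<and> (\<forall>w'\<in>W. \<forall>\<eta>. fenchel c \<eta> w' \<le> B)"
proof -
  obtain x y t where w_eq: "w = ((x, y), t)" by (metis prod.collapse)
  have x: "x \<in> img_of c" using w by (simp add: w_eq phase_dom_def)
  have "\<exists>N B. open N \<and> (x, t) \<in> N \<and> N \<subseteq> img_of c \<times> UNIV \<and>
      (\<forall>z\<in>N. \<forall>\<eta> y'. norm y' \<le> norm y + 1 \<longrightarrow> \<eta> \<bullet> y' - ham c (fst z) \<eta> (snd z) \<le> B)"
  proof (rule locally_bounded_fenchel)
    show "open (img_of c \<times> (UNIV :: real set))" using open_img[OF c] by (simp add: open_Times)
    show "continuous_on ((img_of c \<times> UNIV) \<times> UNIV) (\<lambda>(z, \<eta>). ham c (fst z) \<eta> (snd z))"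
      unfolding case_prod_unfold
      by (rule continuous_on_ham[OF c]) (auto intro!: continuous_intros)
  qed (use x in \<open>auto simp: convex_ham[OF c] superlinear_ham[OF c]\<close>)
  then obtain N B where N: "open N" "(x, t) \<in> N" "N \<subseteq> img_of c \<times> UNIV"
    and B: "\<And>z \<eta> y'. z \<in> N \<Longrightarrow> norm y' \<le> norm y + 1 \<Longrightarrow> \<eta> \<bullet> y' - ham c (fst z) \<eta> (snd z) \<le> B"
    by blast
  let ?W = "(\<lambda>w'. (fst (fst w'), snd w')) -` N \<inter> (\<lambda>w'. norm (snd (fst w'))) -` {..<norm y + 1}"
  have "open ?W"
    using N(1) by (intro open_Int open_vimage continuous_intros open_lessThan)
  then show ?thesis
    using N(2,3) B by (intro exI[of _ ?W] exI[of _ B])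
      (auto simp: w_eq phase_dom_def fenchel_def less_imp_le)
qed

lemma bdd_above_fenchel: "c \<in> A \<Longrightarrow> w \<in> phase_dom c \<Longrightarrow> bdd_above (range (\<lambda>\<eta>. fenchel c \<eta> w))"
  using fenchel_locally_bounded[of c w] by (metis bdd_aboveI2)

lemma continuous_on_fenchel: "c \<in> A \<Longrightarrow> continuous_on (phase_dom c) (fenchel c \<eta>)"
  unfolding fenchel_def
  by (intro continuous_intros continuous_on_ham) (auto simp: phase_dom_def)

lemma legendre_phase_point:
  assumes "c \<in> A" "w \<in> phase_dom c" "phase_point c w = z"
  shows "legendre A H (fst (fst z)) (snd (fst z)) (snd z) = (SUP \<eta>. fenchel c \<eta> w)"
  using fenchel_image[of c w "fst (fst z)" "snd (fst z)" "snd z"] assms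
  by (simp add: legendre_def)

text \<open>Fenchel's inequality holds for the real-valued \<open>SUP\<close> because the set of
  values is bounded above, which superlinearity provides through
  \<open>bdd_above_fenchel\<close>.\<close>

lemma legendre_ge:
  assumes v: "v \<in> tangent_space A q" and p: "p \<in> cotangent_space A q"
  shows "p v - H q p \<tau> \<le> legendre A H q v \<tau>"
proof -
  have "((q, v), \<tau>) \<in> topspace (phase_space A)"
    using v by (simp add: topspace_phase tangent_bundle_def)
  then obtain c w where w: "c \<in> A" "w \<in> phase_dom c" "((q, v), \<tau>) = phase_point c w"
    by (rule phase_point_cover)
  have "bdd_above ((\<lambda>p. p v - H q p \<tau>) ` cotangent_space A q)"
    using bdd_above_fenchel[OF w(1,2)] fenchel_image[OF w(1,2) w(3)[symmetric]] by simp
  then show ?thesis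
    unfolding legendre_def by (rule cSUP_upper[OF p])
qed

lemma integrable_legendre:
  assumes "\<mu> \<in> invariant_measures A L"
  shows "integrable \<mu> (\<lambda>z. legendre A H (fst (fst z)) (snd (fst z)) (snd z))"
proof (rule integrable_phase[OF assms])
  fix c assume c: "c \<in> A"
  have L: "legendre A H (fst (fst (phase_point c w))) (snd (fst (phase_point c w)))
      (snd (phase_point c w)) = (SUP \<eta>. fenchel c \<eta> w)" if "w \<in> phase_dom c" for w
    using legendre_phase_point[OF c that refl] .
  have preimage: "open (phase_dom c \<inter> fenchel c \<eta> -` {a<..})" for \<eta> a
    by (intro continuous_open_preimage continuous_on_fenchel open_phase_dom c open_greaterThan)
  show "open {w \<in> phase_dom c. a < legendre A H (fst (fst (phase_point c w)))
      (snd (fst (phase_point c w))) (snd (phase_point c w))}" for a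
  proof -
    have "{w \<in> phase_dom c. a < legendre A H (fst (fst (phase_point c w)))
        (snd (fst (phase_point c w))) (snd (phase_point c w))} =
        (\<Union>\<eta>. phase_dom c \<inter> fenchel c \<eta> -` {a<..})"
      by (auto simp: L less_cSUP_iff bdd_above_fenchel[OF c])
    moreover have "open (\<Union>\<eta>. phase_dom c \<inter> fenchel c \<eta> -` {a<..})"
      using preimage by (intro open_UN ballI)
    ultimately show ?thesis by (rule ssubst)
  qed
  fix w assume w: "w \<in> phase_dom c"
  obtain W B where W: "open W" "w \<in> W" "W \<subseteq> phase_dom c"
    and B: "\<And>w' \<eta>. w' \<in> W \<Longrightarrow> fenchel c \<eta> w' \<le> B"
    using fenchel_locally_bounded[OF c w] by blast
  \<comment> \<open>The zero covector bounds the Legendre transform below by a continuous function;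
    subtracting \<open>1\<close> gives a constant lower bound valid on a whole neighbourhood of
    \<open>w\<close>.\<close>
  let ?b = "fenchel c 0 w - 1"
  let ?W = "W \<inter> (phase_dom c \<inter> fenchel c 0 -` {?b<..})"
  have "\<bar>legendre A H (fst (fst (phase_point c w'))) (snd (fst (phase_point c w')))
      (snd (phase_point c w'))\<bar> \<le> max B (- ?b)" if w': "w' \<in> ?W" for w'
  proof -
    have "(SUP \<eta>. fenchel c \<eta> w') \<le> B" using w' by (intro cSUP_least B) auto
    moreover have "fenchel c 0 w' \<le> (SUP \<eta>. fenchel c \<eta> w')"
      using w' by (intro cSUP_upper bdd_above_fenchel c) auto
    moreover have "?b < fenchel c 0 w'" using w' by auto
    ultimately show ?thesis using w' by (simp add: L)
  qed
  moreover have "open ?W" using W(1) preimage by (rule open_Int)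
  ultimately show "\<exists>W B. open W \<and> w \<in> W \<and> W \<subseteq> phase_dom c \<and>
      (\<forall>w'\<in>W. \<bar>legendre A H (fst (fst (phase_point c w'))) (snd (fst (phase_point c w')))
        (snd (phase_point c w'))\<bar> \<le> B)"
    using W(2,3) w by (intro exI[of _ ?W] exI[of _ "max B (- ?b)"]) auto
qed

section \<open>The inequality integrated against an invariant measure\<close>

lemma continuous_on_ham_form:
  assumes "\<theta> \<in> closed_forms A"
  shows "continuous_on UNIV (\<lambda>z. H (fst z) (\<theta> (fst z)) (abs_circle (snd z)))"
proof -
  have "continuous_on (dom_of c \<times> UNIV) (\<lambda>z. H (fst z) (\<theta> (fst z)) (abs_circle (snd z)))"
    if c: "c \<in> A" for c
  proof -
    have coord: "continuous_on (dom_of c \<times> (UNIV :: real set)) (\<lambda>z. coord c (fst z))"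
      by (rule continuous_on_compose2[OF continuous_on_coord[OF c]]) (auto intro: continuous_intros)
    have cont: "continuous_on (dom_of c \<times> UNIV)
        (\<lambda>z. ham c (coord c (fst z)) (form_coords A \<theta> c (coord c (fst z))) (snd z))"
      by (intro continuous_on_ham[OF c] coord continuous_intros
          continuous_on_compose2[OF smooth_on_imp_continuous_on[OF smooth_form_coords[OF assms c]] coord])
        (auto simp: coord_in_img)
    have "ham c (coord c q) (form_coords A \<theta> c (coord c q)) t = H q (\<theta> q) (abs_circle t)"
      if "q \<in> dom_of c" for q t
      using form_coords_eq[of c q \<theta>, OF c that closed_form_cotangent[OF assms]] c that
      by (simp add: ham_def point_coord)
    then show ?thesis
      by (intro continuous_on_eq[OF cont]) auto
  qed
  then have "continuous_on (\<Union>c\<in>A. dom_of c \<times> UNIV)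
      (\<lambda>z. H (fst z) (\<theta> (fst z)) (abs_circle (snd z)))"
    by (intro continuous_on_open_UN open_Times open_dom) auto
  moreover have "(\<Union>c\<in>A. dom_of c \<times> UNIV) = (UNIV :: ('m \<times> real) set)"
    using chart_around by (auto simp: set_eq_iff)
  ultimately show ?thesis by simp
qed

text \<open>This is the integrated Fenchel inequality for one form and one measure. Integrability of
  all three terms is established first, because monotonicity and additivity of the integral depend
  on it.\<close>

lemma pairing_le:
  assumes "compact (UNIV :: 'm set)"
    and C: "C \<in> de_rham_H1 A" "\<theta> \<in> C"
    and \<mu>: "\<mu> \<in> invariant_measures A L" "has_rotation_vector A \<mu> h"
  shows "pairing A C h \<le> (\<integral>((q, v), \<tau>). legendre A H q v \<tau> \<partial>\<mu>) +
    integral {0..1} (\<lambda>t. SUP q. H q (\<theta> q) (abs_circle t))"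
proof -
  note \<theta> = de_rham_class_eq[OF C]
  let ?h = "\<lambda>z. H (fst z) (\<theta> (fst z)) (abs_circle (snd z))"
  define F where "F \<tau> = (SUP q. H q (\<theta> q) \<tau>)" for \<tau>
  have "compact (?h ` (UNIV \<times> {0..1}))"
    using continuous_on_ham_form[OF \<theta>(1)] assms(1)
    by (intro compact_continuous_image compact_Times) (auto intro: continuous_on_subset)
  then obtain B where B: "\<And>q t. t \<in> {0..1} \<Longrightarrow> \<bar>H q (\<theta> q) (abs_circle t)\<bar> \<le> B"
    using compact_imp_bounded by (fastforce simp: bounded_iff)
  \<comment> \<open>Compactness gave the bound for times in the unit interval; the fractional part
    of a representative carries it to every point of the circle.\<close>
  have bound: "\<bar>H q (\<theta> q) \<tau>\<bar> \<le> B" for q \<tau>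
  proof -
    have "abs_circle (frac (rep_circle \<tau>)) = \<tau>"
      using abs_circle_frac_add[of "rep_circle \<tau>" 0] by (simp add: abs_rep_circle)
    moreover have "frac (rep_circle \<tau>) \<in> {0..1}"
      using frac_lt_1[of "rep_circle \<tau>"] by simp
    ultimately show ?thesis using B by metis
  qed
  have bdd: "bdd_above (range (\<lambda>q. H q (\<theta> q) \<tau>))" for \<tau>
    using bound by (intro bdd_aboveI2[where M = B]) (auto intro: order_trans[OF abs_ge_self])
  have F_bound: "\<bar>F \<tau>\<bar> \<le> B" for \<tau>
    unfolding F_def using bound by (intro cSup_abs_le) auto
  have F_lsc: "open {t. a < F (abs_circle t)}" for a
  proof -
    have "continuous_on UNIV (\<lambda>t. H q (\<theta> q) (abs_circle t))" for q
      using continuous_on_compose2[OF continuous_on_ham_form[OF \<theta>(1)], of UNIV "\<lambda>t. (q, t)"]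
      by (simp add: continuous_on_Pair)
    then have "open {t. a < H q (\<theta> q) (abs_circle t)}" for q
      by (intro open_Collect_less continuous_on_const)
    moreover have "{t. a < F (abs_circle t)} = (\<Union>q. {t. a < H q (\<theta> q) (abs_circle t)})"
      by (auto simp: F_def less_cSUP_iff bdd)
    ultimately show ?thesis by (simp add: open_UN)
  qed
  note marginal = integral_circle_marginal[OF \<mu>(1) F_lsc F_bound]
  note int_\<theta> = integrable_form[OF \<mu>(1) \<theta>(1)]
  note int_L = integrable_legendre[OF \<mu>(1)]
  have space: "space \<mu> = topspace (phase_space A)"
    using \<mu>(1) by (intro phase_borel_space) (simp add: invariant_measures_def phase_borel_def)
  have "pairing A C h = (\<integral>z. \<theta> (fst (fst z)) (snd (fst z)) \<partial>\<mu>)"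
    using \<mu>(2) \<theta> by (simp add: has_rotation_vector_def case_prod_unfold)
  also have "\<dots> \<le> (\<integral>z. legendre A H (fst (fst z)) (snd (fst z)) (snd z) + F (snd z) \<partial>\<mu>)"
  proof (rule integral_mono[OF int_\<theta> Bochner_Integration.integrable_add[OF int_L marginal(1)]])
    fix z assume "z \<in> space \<mu>"
    then obtain q v \<tau> where z: "z = ((q, v), \<tau>)" "v \<in> tangent_space A q"
      by (auto simp: space topspace_phase tangent_bundle_def)
    have "\<theta> q v - H q (\<theta> q) \<tau> \<le> legendre A H q v \<tau>"
      using legendre_ge[OF z(2) closed_form_cotangent[OF \<theta>(1)]] .
    moreover have "H q (\<theta> q) \<tau> \<le> F \<tau>"
      unfolding F_def by (rule cSUP_upper[OF UNIV_I bdd])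
    ultimately show "\<theta> (fst (fst z)) (snd (fst z)) \<le>
        legendre A H (fst (fst z)) (snd (fst z)) (snd z) + F (snd z)"
      using z(1) by simp
  qed
  also have "\<dots> = (\<integral>((q, v), \<tau>). legendre A H q v \<tau> \<partial>\<mu>) + integral {0..1} (\<lambda>t. F (abs_circle t))"
    by (simp add: Bochner_Integration.integral_add[OF int_L marginal(1)] marginal(2) case_prod_unfold)
  finally show ?thesis by (simp add: F_def)
qed

end

theorem proposition2:
  fixes A :: "('m::{t2_space, second_countable_topology}, 'n::finite) chart set"
    and g :: "'m \<Rightarrow> ('m, 'n) tvec \<Rightarrow> ('m, 'n) tvec \<Rightarrow> real"
    and H :: "('m, 'n) hamiltonian"
    and C :: "('m, 'n) one_form set"
  assumes "smooth_atlas A"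
    and "compact (UNIV :: 'm set)"
    and "connected (UNIV :: 'm set)"
    and "orientable A"
    and "riemannian_metric A g"
    and "no_contractible_closed_geodesics A g"
    and "smooth_hamiltonian A H"
    and "positive_fibre_hessian A H"
    and "superlinear A g H"
    and "complete_flow A (legendre A H)"
    and "C \<in> de_rham_H1 A"
  shows "mather_alpha A (legendre A H) C \<le> critical_value A H C"
proof -
  interpret tonelli_hamiltonian A g H
    using assms by unfold_locales
  show ?thesis
    unfolding mather_alpha_def critical_value_def
  proof (intro SUP_least INF_greatest)
    fix h \<theta> assume \<theta>: "\<theta> \<in> C"
    define r where "r = integral {0..1} (\<lambda>t. SUP q. H q (\<theta> q) (abs_circle t))"
    \<comment> \<open>The estimate is phrased as a lower bound for \<open>mather_beta\<close>, so
      that it also covers an empty set of measures, where the infimum is \<infinity>.\<close>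
    have "ereal (pairing A C h - r) \<le> mather_beta A (legendre A H) h"
      unfolding mather_beta_def
    proof (rule INF_greatest)
      fix \<mu> assume "\<mu> \<in> {\<mu> \<in> invariant_measures A (legendre A H). has_rotation_vector A \<mu> h}"
      then show "ereal (pairing A C h - r) \<le> ereal (\<integral>((q, v), \<tau>). legendre A H q v \<tau> \<partial>\<mu>)"
        using pairing_le[OF assms(2,11) \<theta>, of \<mu> "legendre A H" h] by (simp add: r_def)
    qed
    \<comment> \<open>The real lower bound excludes the value -\<infinity>; for \<infinity> the
      difference is -\<infinity>, and for a finite value the inequality is rearranged.\<close>
    then show "ereal (pairing A C h) - mather_beta A (legendre A H) h \<le> ereal r"
      by (cases "mather_beta A (legendre A H) h") auto
  qed
qed

end
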